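(* Let $(\Sigma)$: $\dot g=\mathcal X(g)+\sum_{j=1}^m u_jB_j(g)$ be a linear system on the generalized Heisenberg group $\mathbb{H}^n$, let $D$ be the derivation associated to $\mathcal X$, let $Z$ be a generator of the center of $\mathfrak h^n$, and let $d\in\mathbb R$ be defined by $DZ=dZ$. If $(\Sigma)$ satisfies the ad-rank condition and is singular, that is $d=0$, then $(\Sigma)$ is controllable.
   Context: $\mathbb{H}^n$ is the $(2n+1)$-dimensional simply connected Lie group of real $(n+2)\times(n+2)$ upper triangular matrices with ones on the diagonal, first row $(1,y_1,\dots,y_n,z)$, last column $(z,x_1,\dots,x_n,1)^T$, and all other off-diagonal entries $0$. Its Lie algebra $\mathfrak h^n$ (the right-invariant vector fields) has basis $X_i=\partial/\partial x_i$, $Y_i=\partial/\partial y_i+x_i\,\partial/\partial z$ $(1\le i\le n)$, $Z=\partial/\partial z$, with $[X_i,Y_i]=Z$ and all other brackets zero; its center is $\mathbb RZ$, equal to the derived algebra. A vector field $\mathcal X$ on a connected Lie group $G$ is linear if its flow is a one-parameter group of automorphisms of $G$; the associated derivation of the Lie algebra $\mathfrak g$ (of right-invariant vector fields) is $D=-\mathrm{ad}(\mathcal X)$. A linear system is a control system $\dot g=\mathcal X(g)+\sum_{j=1}^m u_jB_j(g)$ with $\mathcal X$ linear, the $B_j$ right-invariant, and inputs $u=(u_1,\dots,u_m)$ measurable, locally bounded, with values in $\mathbb R^m$. It is controllable if for all $g,h\in G$ some input steers $g$ to $h$ in some time $T\ge 0$. Ad-rank condition: let $\mathfrak h$ be the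 Lie subalgebra of $\mathfrak g$ generated by $B_1,\dots,B_m$; the system satisfies the ad-rank condition if the smallest $D$-invariant linear subspace containing $\mathfrak h$, namely $\mathrm{Span}\{D^kY:\ Y\in\mathfrak h,\ k\in\mathbb N\}$, is equal to $\mathfrak g$. *)

theory Defs
  imports "HOL-Analysis.Analysis" "HOL-Library.Function_Algebras"
begin

section \<open>Vector fields on a Euclidean space\<close>

text \<open>Vector fields are functions, and form a real vector space under the pointwise operations.\<close>

instantiation "fun" :: (type, scaleR) scaleR
begin

definition scaleR_fun_def: "c *\<^sub>R f = (\<lambda>x. c *\<^sub>R f x)"

instance ..

end

lemma scaleR_fun_apply [simp]: "(c *\<^sub>R f) x = c *\<^sub>R f x"
  by (simp add: scaleR_fun_def)

instance "fun" :: (type, real_vector) real_vector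
  by standard (auto simp: fun_eq_iff algebra_simps)

text \<open>On finite-dimensional spaces, \<open>C\<^sup>k\<close> regularity can be tested direction by direction.\<close>

primrec Ck :: "nat \<Rightarrow> ('a::euclidean_space \<Rightarrow> 'b::euclidean_space) \<Rightarrow> bool" where
  "Ck 0 f \<longleftrightarrow> continuous_on UNIV f"
| "Ck (Suc k) f \<longleftrightarrow> f differentiable_on UNIV \<and> (\<forall>v. Ck k (\<lambda>x. frechet_derivative f (at x) v))"

definition smooth :: "('a::euclidean_space \<Rightarrow> 'b::euclidean_space) \<Rightarrow> bool" where
  "smooth f \<longleftrightarrow> (\<forall>k. Ck k f)"

text \<open>The sign convention is the one for which \<open>[V,W] = V W - W V\<close> as derivations of functions.\<close>

definition lie_bracket :: "('a::euclidean_space \<Rightarrow> 'a) \<Rightarrow> ('a \<Rightarrow> 'a) \<Rightarrow> 'a \<Rightarrow> 'a" where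
  "lie_bracket V W =
    (\<lambda>g. frechet_derivative W (at g) (V g) - frechet_derivative V (at g) (W g))"


section \<open>The generalized Heisenberg group\<close>

text \<open>
  A group element is represented by its global coordinates \<open>(x, y, z)\<close>, so that tangent
  spaces are identified with the coordinate space itself. The map \<open>heis_matrix\<close> below is the
  actual matrix realization; indices are ordered as first, middle (by \<open>'n\<close>), last.
\<close>

type_synonym 'n heis = "(real^'n) \<times> (real^'n) \<times> real"

type_synonym 'n idx = "unit + 'n + unit"

abbreviation (input) fst_idx :: "'n idx" where "fst_idx \<equiv> Inl ()"
abbreviation (input) mid_idx :: "'n \<Rightarrow> 'n idx" where "mid_idx i \<equiv> Inr (Inl i)"
abbreviation (input) lst_idx :: "'n idx" where "lst_idx \<equiv> Inr (Inr ())"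

definition heis_matrix :: "'n::finite heis \<Rightarrow> real ^ 'n idx ^ 'n idx" where
  "heis_matrix = (\<lambda>(x, y, z). \<chi> r c.
     if r = c then 1
     else case (r, c) of
       (Inl _, Inr (Inl i)) \<Rightarrow> y $ i
     | (Inl _, Inr (Inr _)) \<Rightarrow> z
     | (Inr (Inl i), Inr (Inr _)) \<Rightarrow> x $ i
     | _ \<Rightarrow> 0)"

definition heis_mult :: "'n::finite heis \<Rightarrow> 'n heis \<Rightarrow> 'n heis"  (infixl "\<odot>" 70) where
  "g \<odot> h = (case (g, h) of ((x, y, z), (x', y', z')) \<Rightarrow> (x + x', y + y', z + z' + y \<bullet> x'))"

lemma sum_idx:
  fixes f :: "'n::finite idx \<Rightarrow> real"
  shows "(\<Sum>k\<in>UNIV. f k) = f fst_idx + (\<Sum>i\<in>UNIV. f (mid_idx i)) + f lst_idx"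
proof -
  have "(\<Sum>k\<in>UNIV. f k) = (\<Sum>k\<in>UNIV <+> (UNIV <+> UNIV). f k)"
    by (simp only: UNIV_Plus_UNIV)
  also have "\<dots> = f fst_idx + (\<Sum>i\<in>UNIV. f (mid_idx i)) + f lst_idx"
    by (simp add: sum.Plus UNIV_unit del: UNIV_Plus_UNIV)
  finally show ?thesis .
qed

lemma heis_matrix_nth [simp]:
  "heis_matrix (x, y, z) $ Inl u $ Inl v = 1"
  "heis_matrix (x, y, z) $ Inl u $ Inr (Inl i) = y $ i"
  "heis_matrix (x, y, z) $ Inl u $ Inr (Inr v) = z"
  "heis_matrix (x, y, z) $ Inr (Inl i) $ Inl v = 0"
  "heis_matrix (x, y, z) $ Inr (Inl i) $ Inr (Inl j) = (if i = j then 1 else 0)"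
  "heis_matrix (x, y, z) $ Inr (Inl i) $ Inr (Inr v) = x $ i"
  "heis_matrix (x, y, z) $ Inr (Inr u) $ Inl v = 0"
  "heis_matrix (x, y, z) $ Inr (Inr u) $ Inr (Inl j) = 0"
  "heis_matrix (x, y, z) $ Inr (Inr u) $ Inr (Inr v) = 1"
  by (simp_all add: heis_matrix_def)

lemma heis_matrix_mult: "heis_matrix (g \<odot> h) = heis_matrix g ** heis_matrix h"
proof -
  obtain x y z x' y' z' where gh: "g = (x, y, z)" "h = (x', y', z')"
    by (metis prod_cases3)
  have "heis_matrix (g \<odot> h) $ r $ c = (heis_matrix g ** heis_matrix h) $ r $ c" for r c
  proof -
    have "(\<exists>u. r = Inl u) \<or> (\<exists>i. r = Inr (Inl i)) \<or> (\<exists>u. r = Inr (Inr u))"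
      "(\<exists>u. c = Inl u) \<or> (\<exists>i. c = Inr (Inl i)) \<or> (\<exists>u. c = Inr (Inr u))"
      by (metis sum.exhaust)+
    then show ?thesis
      by (elim disjE exE)
         (simp_all add: gh heis_mult_def matrix_matrix_mult_def sum_idx inner_vec_def
           if_distrib [of "\<lambda>t. t * _"] if_distrib [of "\<lambda>t. _ * t"] cong: if_cong)
  qed
  then show ?thesis
    by (simp add: vec_eq_iff)
qed

lemma inj_heis_matrix: "inj (heis_matrix :: 'n::finite heis \<Rightarrow> _)"
proof (rule injI)
  fix g h :: "'n heis"
  assume "heis_matrix g = heis_matrix h"
  moreover obtain x y z x' y' z' where gh: "g = (x, y, z)" "h = (x', y', z')"
    by (metis prod_cases3)
  ultimately have eq: "heis_matrix (x, y, z) $ r $ c = heis_matrix (x', y', z') $ r $ c" for r c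
    by simp
  have "y $ i = y' $ i" for i
    using eq [of fst_idx "mid_idx i"] by simp
  moreover have "z = z'"
    using eq [of fst_idx lst_idx] by simp
  moreover have "x $ i = x' $ i" for i
    using eq [of "mid_idx i" lst_idx] by simp
  ultimately show "g = h"
    by (simp add: gh vec_eq_iff)
qed

lemma range_heis_matrix:
  "range heis_matrix = {A :: real ^ 'n::finite idx ^ 'n idx.
     (\<forall>r. A $ r $ r = 1) \<and>
     (\<forall>i j. i \<noteq> j \<longrightarrow> A $ mid_idx i $ mid_idx j = 0) \<and>
     (\<forall>i. A $ mid_idx i $ fst_idx = 0 \<and> A $ lst_idx $ mid_idx i = 0) \<and>
     A $ lst_idx $ fst_idx = 0}" (is "_ = ?M")
proof
  have "heis_matrix (x, y, z) \<in> ?M" for x y :: "real ^ 'n" and z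
  proof -
    have "heis_matrix (x, y, z) $ r $ r = 1" for r
      by (metis heis_matrix_nth(1,5,9) sum.exhaust)
    then show ?thesis
      by simp
  qed
  then show "range heis_matrix \<subseteq> ?M"
    by fast
  show "?M \<subseteq> range heis_matrix"
  proof
    fix A assume A: "A \<in> ?M"
    let ?g = "(\<chi> i. A $ mid_idx i $ lst_idx, \<chi> i. A $ fst_idx $ mid_idx i, A $ fst_idx $ lst_idx)"
    have "A $ r $ c = heis_matrix ?g $ r $ c" for r c
    proof -
      have "(\<exists>u. r = Inl u) \<or> (\<exists>i. r = Inr (Inl i)) \<or> (\<exists>u. r = Inr (Inr u))"
        "(\<exists>u. c = Inl u) \<or> (\<exists>i. c = Inr (Inl i)) \<or> (\<exists>u. c = Inr (Inr u))"
        by (metis sum.exhaust)+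
      then show ?thesis
        using A by (elim disjE exE) (simp_all only: heis_matrix_nth, auto)
    qed
    then have "A = heis_matrix ?g"
      unfolding vec_eq_iff by blast
    then show "A \<in> range heis_matrix"
      by blast
  qed
qed

text \<open>
  The Lie algebra of right-invariant vector fields: those preserved by the differentials of
  all right translations.
\<close>

definition right_invariant :: "('n::finite heis \<Rightarrow> 'n heis) \<Rightarrow> bool" where
  "right_invariant V \<longleftrightarrow>
    smooth V \<and> (\<forall>g h. V (g \<odot> h) = frechet_derivative (\<lambda>k. k \<odot> h) (at g) (V g))"

definition heis_algebra :: "('n::finite heis \<Rightarrow> 'n heis) set" where
  "heis_algebra = {V. right_invariant V}"

definition heis_center :: "('n::finite heis \<Rightarrow> 'n heis) set" where
  "heis_center = {V \<in> heis_algebra. \<forall>W\<in>heis_algebra. lie_bracket V W = 0}"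

definition lie_subalgebra :: "('n::finite heis \<Rightarrow> 'n heis) set \<Rightarrow> bool" where
  "lie_subalgebra S \<longleftrightarrow> S \<subseteq> heis_algebra \<and> subspace S \<and> (\<forall>V\<in>S. \<forall>W\<in>S. lie_bracket V W \<in> S)"


text \<open>
  The fields \<open>\<Sum>\<^sub>i a\<^sub>i X\<^sub>i + b\<^sub>i Y\<^sub>i + c Z\<close>, where \<open>X\<^sub>i = \<partial>/\<partial>x\<^sub>i\<close>,
  \<open>Y\<^sub>i = \<partial>/\<partial>y\<^sub>i + x\<^sub>i \<partial>/\<partial>z\<close> and \<open>Z = \<partial>/\<partial>z\<close>; they make up the whole Lie algebra.
\<close>

definition heis_field :: "real^'n::finite \<Rightarrow> real^'n \<Rightarrow> real \<Rightarrow> 'n heis \<Rightarrow> 'n heis" where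
  "heis_field a b c = (\<lambda>(x, y, z). (a, b, c + b \<bullet> x))"

lemma Ck_const: "Ck k (\<lambda>x. c)"
  by (induction k arbitrary: c) (simp_all add: frechet_derivative_const)

lemma has_derivative_heis_field:
  "(heis_field a b c has_derivative (\<lambda>(v, w, r). (0, 0, b \<bullet> v))) (at g)"
proof -
  have "((\<lambda>g. (a, b, c + b \<bullet> fst g)) has_derivative (\<lambda>v. (0, 0, b \<bullet> fst v))) (at g)"
    by (auto intro!: derivative_eq_intros)
  then show ?thesis
    by (simp add: heis_field_def case_prod_unfold)
qed

lemma smooth_heis_field: "smooth (heis_field a b c)"
  unfolding smooth_def
proof
  fix k
  have "frechet_derivative (heis_field a b c) (at g) = (\<lambda>(v, w, r). (0, 0, b \<bullet> v))" for g
    using has_derivative_heis_field by (rule frechet_derivative_at [symmetric])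
  moreover have "heis_field a b c differentiable_on UNIV"
    using has_derivative_heis_field unfolding differentiable_on_def differentiable_def by blast
  ultimately show "Ck k (heis_field a b c)"
    by (cases k) (auto simp: Ck_const differentiable_imp_continuous_on split: prod.splits)
qed

lemma frechet_derivative_right_translation:
  "frechet_derivative (\<lambda>k. k \<odot> h) (at g) = (\<lambda>(v, w, r). (v, w, r + w \<bullet> fst h))"
proof -
  have "((\<lambda>k. (fst k + fst h, fst (snd k) + fst (snd h),
           snd (snd k) + snd (snd h) + fst (snd k) \<bullet> fst h)) has_derivative
         (\<lambda>v. (fst v, fst (snd v), snd (snd v) + fst (snd v) \<bullet> fst h))) (at g)"
    by (auto intro!: derivative_eq_intros)
  then have "((\<lambda>k. k \<odot> h) has_derivative (\<lambda>(v, w, r). (v, w, r + w \<bullet> fst h))) (at g)"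
    by (simp add: heis_mult_def case_prod_unfold)
  then show ?thesis
    by (rule frechet_derivative_at [symmetric])
qed

lemma heis_algebra_eq: "(heis_algebra :: ('n::finite heis \<Rightarrow> 'n heis) set) = {heis_field a b c | a b c. True}"
proof (intro set_eqI iffI)
  fix V :: "'n heis \<Rightarrow> 'n heis"
  assume "V \<in> heis_algebra"
  then have V: "V (g \<odot> h) = (\<lambda>(v, w, r). (v, w, r + w \<bullet> fst h)) (V g)" for g h
    unfolding heis_algebra_def right_invariant_def frechet_derivative_right_translation by blast
  obtain a b c where V0: "V 0 = (a, b, c)"
    by (metis prod_cases3)
  have "V h = heis_field a b c h" for h
  proof -
    have "0 \<odot> h = h"
      by (cases h) (simp add: heis_mult_def zero_prod_def)
    then show ?thesis
      using V [of 0 h] V0 by (simp add: heis_field_def case_prod_unfold)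
  qed
  then show "V \<in> {heis_field a b c | a b c. True}"
    by blast
next
  fix V :: "'n heis \<Rightarrow> 'n heis"
  assume "V \<in> {heis_field a b c | a b c. True}"
  then obtain a b c where V: "V = heis_field a b c"
    by blast
  show "V \<in> heis_algebra"
    by (simp add: heis_algebra_def right_invariant_def V smooth_heis_field
        frechet_derivative_right_translation)
       (simp add: heis_field_def heis_mult_def case_prod_unfold inner_add_right)
qed

lemma lie_bracket_heis_field:
  "lie_bracket (heis_field a b c) (heis_field a' b' c') = heis_field 0 0 (a \<bullet> b' - a' \<bullet> b)"
proof -
  have "frechet_derivative (heis_field a b c) (at g) = (\<lambda>(v, w, r). (0, 0, b \<bullet> v))"
    for a b :: "real ^ 'a" and c g
    using has_derivative_heis_field by (rule frechet_derivative_at [symmetric])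
  then show ?thesis
    by (simp add: lie_bracket_def) (auto simp: heis_field_def fun_eq_iff inner_commute)
qed

section \<open>Linear systems\<close>

definition lie_group_automorphism :: "('n::finite heis \<Rightarrow> 'n heis) \<Rightarrow> bool" where
  "lie_group_automorphism \<phi> \<longleftrightarrow>
    bij \<phi> \<and> smooth \<phi> \<and> smooth (inv \<phi>) \<and> (\<forall>g h. \<phi> (g \<odot> h) = \<phi> g \<odot> \<phi> h)"

definition flow_of :: "('a::euclidean_space \<Rightarrow> 'a) \<Rightarrow> (real \<Rightarrow> 'a \<Rightarrow> 'a) \<Rightarrow> bool" where
  "flow_of X \<phi> \<longleftrightarrow>
    (\<forall>g. \<phi> 0 g = g) \<and>
    (\<forall>g t. ((\<lambda>s. \<phi> s g) has_vector_derivative X (\<phi> t g)) (at t))"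

definition linear_vector_field :: "('n::finite heis \<Rightarrow> 'n heis) \<Rightarrow> bool" where
  "linear_vector_field X \<longleftrightarrow> smooth X \<and>
    (\<exists>\<phi>. flow_of X \<phi> \<and> (\<forall>t. lie_group_automorphism (\<phi> t)) \<and> (\<forall>s t. \<phi> (s + t) = \<phi> s \<circ> \<phi> t))"

definition derivation :: "('n::finite heis \<Rightarrow> 'n heis) \<Rightarrow> ('n heis \<Rightarrow> 'n heis) \<Rightarrow> 'n heis \<Rightarrow> 'n heis" where
  "derivation X V = - lie_bracket X V"

definition linear_system ::
  "('n::finite heis \<Rightarrow> 'n heis) \<Rightarrow> ('m::finite \<Rightarrow> 'n heis \<Rightarrow> 'n heis) \<Rightarrow> bool" where
  "linear_system X B \<longleftrightarrow> linear_vector_field X \<and> (\<forall>j. B j \<in> heis_algebra)"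

definition ad_rank_condition ::
  "('n::finite heis \<Rightarrow> 'n heis) \<Rightarrow> ('m::finite \<Rightarrow> 'n heis \<Rightarrow> 'n heis) \<Rightarrow> bool" where
  "ad_rank_condition X B \<longleftrightarrow>
    span {(derivation X ^^ k) V | k V. V \<in> lie_subalgebra hull (range B)} = heis_algebra"

definition admissible_input :: "(real \<Rightarrow> real ^ 'm::finite) \<Rightarrow> bool" where
  "admissible_input u \<longleftrightarrow>
    u \<in> borel_measurable (lebesgue_on {0..}) \<and> (\<forall>T\<ge>0. bounded (u ` {0..T}))"

text \<open>
  Inputs are only measurable, so trajectories are solutions in the sense of Caratheodory, i.e.\
  continuous solutions of the integral equation. The integrand is bounded and measurable on
  \<open>{0..T}\<close>, so the Henstock--Kurzweil and Lebesgue integrals agree here.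
\<close>

definition trajectory ::
  "('n::finite heis \<Rightarrow> 'n heis) \<Rightarrow> ('m::finite \<Rightarrow> 'n heis \<Rightarrow> 'n heis) \<Rightarrow>
    (real \<Rightarrow> real ^ 'm) \<Rightarrow> real \<Rightarrow> (real \<Rightarrow> 'n heis) \<Rightarrow> bool" where
  "trajectory X B u T \<gamma> \<longleftrightarrow> continuous_on {0..T} \<gamma> \<and>
    (\<forall>t\<in>{0..T}. ((\<lambda>s. X (\<gamma> s) + (\<Sum>j\<in>UNIV. (u s $ j) *\<^sub>R B j (\<gamma> s)))
       has_integral (\<gamma> t - \<gamma> 0)) {0..t})"

definition controllable ::
  "('n::finite heis \<Rightarrow> 'n heis) \<Rightarrow> ('m::finite \<Rightarrow> 'n heis \<Rightarrow> 'n heis) \<Rightarrow> bool" where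
  "controllable X B \<longleftrightarrow>
    (\<forall>g h. \<exists>u T \<gamma>. admissible_input u \<and> 0 \<le> T \<and> trajectory X B u T \<gamma> \<and> \<gamma> 0 = g \<and> \<gamma> T = h)"

end

theory Submission imports Defs "HOL-Computational_Algebra.Polynomial" begin

text \<open>
  In the coordinates of the exponential map the group law is
  \<open>(v, q) (v', q') = (v + v', q + q' + \<omega>(v, v'))\<close> with the symplectic form \<open>\<omega>\<close> of
  \<open>heis_omega\<close> on the first two components. There a linear vector field with
  \<open>d = 0\<close> is a linear map \<open>D\<close> that kills the central direction \<open>Z\<close>
  (\<open>linear_vector_field_exp_coord\<close>), and the right-invariant field with value \<open>b\<close> at the
  identity is \<open>w \<mapsto> b + \<omega>(b, w) Z\<close>. The system therefore reads
  \<open>w' = D w + \<Sum>\<^sub>j u\<^sub>j b\<^sub>j + \<omega>(\<Sum>\<^sub>j u\<^sub>j b\<^sub>j, w) Z\<close>, and its right-hand side does not depend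
  on the central coordinate. So each solution of the linear control system
  \<open>w' = D w + \<Sum>\<^sub>j u\<^sub>j b\<^sub>j\<close> lifts to a trajectory in the group from any central translate of its
  starting point, and the lift adds the area \<open>\<integral> \<omega>(\<Sum>\<^sub>j u\<^sub>j b\<^sub>j, w)\<close> to the central coordinate
  (\<open>steers_of_linear_arc\<close>).

  Let \<open>K\<close> be the span of all \<open>D\<^sup>k b\<^sub>j\<close>. By Kalman's criterion the linear system steers every point
  of \<open>K\<close> to the origin and the origin to every point of \<open>K\<close>. The ad-rank condition implies that \<open>K\<close>
  and \<open>Z\<close> together span everything, and that \<open>Z \<in> K\<close> or some \<open>\<omega>(b\<^sub>i, b\<^sub>j)\<close> is nonzero
  (\<open>ad_rank_dichotomy\<close>). Since the system is invariant under central translations,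
  controllability reduces to moving along the center by an arbitrary amount \<open>r\<close>.

  If \<open>Z \<in> K\<close>, the linear system steers \<open>0\<close> to \<open>Z\<close>. Multiplying that arc by \<open>\<sigma>\<close> gives the central
  displacement \<open>\<sigma> + \<sigma>\<^sup>2 Q\<close>, which takes all values near \<open>0\<close>, and repetition gives all values
  (\<open>steers_along_center_of_span\<close>). If \<open>\<omega>(b\<^sub>i, b\<^sub>j) \<noteq> 0\<close>, there are loops of the linear system with
  area of either sign: run fast enough, the drift \<open>D\<close> is negligible, and the area has the sign that
  a loop in the plane of \<open>b\<^sub>i\<close> and \<open>b\<^sub>j\<close> would give. Scaling such a loop by \<open>\<sigma>\<close> multiplies the area
  by \<open>\<sigma>\<^sup>2\<close> (\<open>steers_along_center_of_area\<close>).

  All arcs are given by an explicit polynomial formula (\<open>flat_arc\<close>), whose coefficients depend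
  polynomially on the speed of the drift. Hence loops close exactly at every speed, and their area
  is a continuous function of it.
\<close>

section \<open>Exponential coordinates\<close>

text \<open>
  Half of a symplectic form on the first two components: the cocycle of the group law in exponential
  coordinates.
\<close>

definition heis_omega :: "'n::finite heis \<Rightarrow> 'n heis \<Rightarrow> real" where
  "heis_omega v w = (fst (snd v) \<bullet> fst w - fst v \<bullet> fst (snd w)) / 2"

text \<open>
  The exponential map composed with the coordinates of the group: along a one-parameter subgroup
  with direction \<open>(a, b, c)\<close> the last coordinate at time \<open>1\<close> is \<open>c + a \<bullet> b / 2\<close>.
\<close>

definition exp_coord :: "'n::finite heis \<Rightarrow> 'n heis" where
  "exp_coord w = (fst w, fst (snd w), snd (snd w) + fst w \<bullet> fst (snd w) / 2)"

text \<open>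
  The differential of \<open>exp_coord\<close> at \<open>w\<close>.
\<close>

definition exp_coord_deriv :: "'n::finite heis \<Rightarrow> 'n heis \<Rightarrow> 'n heis" where
  "exp_coord_deriv w v =
    (fst v, fst (snd v), snd (snd v) + (fst v \<bullet> fst (snd w) + fst w \<bullet> fst (snd v)) / 2)"

definition field_at_one :: "'n::finite heis \<Rightarrow> 'n heis \<Rightarrow> 'n heis" where
  "field_at_one e = heis_field (fst e) (fst (snd e)) (snd (snd e))"

abbreviation unit_Z :: "'n::finite heis" where "unit_Z \<equiv> (0, 0, 1)"

text \<open>
  Additivity carries the derivative at \<open>0\<close> to every other point, so \<open>f - f'\<close> has derivative zero
  everywhere and \<open>f\<close> agrees with its derivative.
\<close>

lemma has_derivative_additive_imp_linear:
  fixes f :: "'a::real_normed_vector \<Rightarrow> 'b::real_normed_vector"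
  assumes add: "\<And>x y. f (x + y) = f x + f y" and der: "(f has_derivative f') (at 0)"
  shows "linear f"
proof -
  have lin: "bounded_linear f'"
    using der by (rule has_derivative_bounded_linear)
  have f0: "f 0 = 0"
    using add[of 0 0] by simp
  have "(f has_derivative f') (at x)" for x
  proof -
    have "((\<lambda>y. f (y - x)) has_derivative f') (at x)"
      using der by (intro derivative_eq_intros has_derivative_compose[of "\<lambda>y. y - x" "\<lambda>h. h" _ _ f f'] | simp)+
    then have "((\<lambda>y. f x + f (y - x)) has_derivative f') (at x)"
      by (auto intro!: derivative_eq_intros)
    then show ?thesis
      by (simp flip: add)
  qed
  then have "((\<lambda>x. f x - f' x) has_derivative (\<lambda>h. 0)) (at x)" for x
    using lin by (auto intro!: derivative_eq_intros bounded_linear_imp_has_derivative)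
  then have "f x - f' x = f 0 - f' 0" for x
    by (intro has_derivative_zero_unique[of UNIV]) auto
  then have "f = f'"
    using f0 lin by (auto simp: linear_0[OF bounded_linear.linear])
  then show ?thesis
    using lin by (simp add: bounded_linear.linear)
qed

text \<open>
  Differentiating \<open>\<phi>\<^sub>t (g h) = \<phi>\<^sub>t g \<phi>\<^sub>t h\<close> at \<open>t = 0\<close> gives a Leibniz rule: the group structure
  becomes an algebraic identity for the field itself.
\<close>

lemma linear_vector_field_mult:
  fixes X :: "'n::finite heis \<Rightarrow> 'n heis"
  assumes "linear_vector_field X"
  shows "X (g \<odot> h) = (fst (X g) + fst (X h), fst (snd (X g)) + fst (snd (X h)),
     snd (snd (X g)) + snd (snd (X h)) + fst (snd (X g)) \<bullet> fst h + fst (snd g) \<bullet> fst (X h))"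
proof -
  obtain \<phi> where "flow_of X \<phi>" and aut: "\<And>t. lie_group_automorphism (\<phi> t)"
    using assms unfolding linear_vector_field_def by blast
  then have id: "\<phi> 0 g = g" and der: "((\<lambda>s. \<phi> s g) has_vector_derivative X g) (at 0)" for g
    unfolding flow_of_def by metis+
  have hom: "\<phi> t (g \<odot> h) = \<phi> t g \<odot> \<phi> t h" for t
    using aut unfolding lie_group_automorphism_def by blast
  have "((\<lambda>s. (fst (\<phi> s g) + fst (\<phi> s h), fst (snd (\<phi> s g)) + fst (snd (\<phi> s h)),
        snd (snd (\<phi> s g)) + snd (snd (\<phi> s h)) + fst (snd (\<phi> s g)) \<bullet> fst (\<phi> s h)))
      has_vector_derivative (fst (X g) + fst (X h), fst (snd (X g)) + fst (snd (X h)),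
        snd (snd (X g)) + snd (snd (X h)) + fst (snd (X g)) \<bullet> fst h + fst (snd g) \<bullet> fst (X h))) (at 0)"
    using der[of g, unfolded has_vector_derivative_def] der[of h, unfolded has_vector_derivative_def]
    unfolding has_vector_derivative_def
    by (auto intro!: derivative_eq_intros simp: id algebra_simps)
  moreover have "((\<lambda>s. \<phi> s g \<odot> \<phi> s h) has_vector_derivative X (g \<odot> h)) (at 0)"
    using der[of "g \<odot> h"] by (simp add: hom)
  ultimately show ?thesis
    by (simp add: heis_mult_def case_prod_unfold vector_derivative_unique_at)
qed

lemma has_derivative_field_at_one:
  "(field_at_one e has_derivative (\<lambda>v. (0, 0, fst (snd e) \<bullet> fst v))) (at g)"
  using has_derivative_heis_field[of "fst e" "fst (snd e)" "snd (snd e)" g]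
  by (simp add: field_at_one_def case_prod_unfold)

lemma field_at_one_apply:
  "field_at_one e g = (fst e, fst (snd e), snd (snd e) + fst (snd e) \<bullet> fst g)"
  by (simp add: field_at_one_def heis_field_def case_prod_unfold)

lemma lie_bracket_field_at_one:
  "lie_bracket (field_at_one e) (field_at_one e') = field_at_one ((2 * heis_omega e' e) *\<^sub>R unit_Z)"
  by (simp add: field_at_one_def lie_bracket_heis_field heis_omega_def inner_commute diff_divide_distrib)

lemma range_field_at_one: "range field_at_one = heis_algebra"
  unfolding heis_algebra_eq field_at_one_def by (auto simp: image_iff) (metis fst_conv snd_conv)

lemma linear_field_at_one: "linear field_at_one"
  by (rule linearI) (auto simp: field_at_one_apply fun_eq_iff inner_add_left algebra_simps)

lemma inj_field_at_one: "inj field_at_one"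
proof (rule injI)
  fix e e' :: "'a heis"
  assume "field_at_one e = field_at_one e'"
  then have "field_at_one e 0 = field_at_one e' 0" by simp
  then show "e = e'"
    by (simp add: field_at_one_apply prod_eq_iff)
qed

text \<open>
  The symplectic form is nondegenerate modulo \<open>Z\<close>, so the center consists of the multiples of the
  field \<open>Z\<close>; its generator cannot vanish because the center is not trivial.
\<close>

lemma center_generator:
  fixes Z :: "'n::finite heis \<Rightarrow> 'n heis"
  assumes "span {Z} = heis_center"
  obtains c where "c \<noteq> 0" "Z = field_at_one (c *\<^sub>R unit_Z)"
proof -
  have "Z \<in> heis_center"
    using assms span_base by blast
  then obtain e where Z: "Z = field_at_one e" and
    br: "\<And>e'. lie_bracket (field_at_one e) (field_at_one e') = 0"
    unfolding heis_center_def range_field_at_one[symmetric] by auto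
  have om: "heis_omega e' e = 0" for e'
  proof -
    have "field_at_one ((2 * heis_omega e' e) *\<^sub>R unit_Z) 0 = (0 :: 'n heis)"
      using br[of e'] unfolding lie_bracket_field_at_one by simp
    then show ?thesis
      by (simp add: field_at_one_apply prod_eq_iff)
  qed
  have e: "e = snd (snd e) *\<^sub>R unit_Z"
    using om[of "(0, fst e, 0)"] om[of "(fst (snd e), 0, 0)"]
    by (simp add: heis_omega_def prod_eq_iff)
  have "field_at_one unit_Z \<in> (heis_center :: ('n heis \<Rightarrow> 'n heis) set)"
    unfolding heis_center_def range_field_at_one[symmetric]
    by (auto simp: lie_bracket_field_at_one heis_omega_def field_at_one_apply fun_eq_iff prod_eq_iff)
  then have "field_at_one unit_Z \<in> span {Z}"
    using assms by simp
  moreover have "field_at_one unit_Z \<noteq> (0 :: 'n heis \<Rightarrow> 'n heis)"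
    by (auto simp: fun_eq_iff field_at_one_apply prod_eq_iff)
  ultimately have "Z \<noteq> 0"
    by (auto simp: span_singleton)
  then have "snd (snd e) \<noteq> 0"
    using e Z linear_0[OF linear_field_at_one] by (metis scaleR_zero_left)
  then show ?thesis
    using that e Z by metis
qed

text \<open>
  The hypothesis on the derivation says that the field does not depend on \<open>z\<close>. Write \<open>D\<close> for the field
  in exponential coordinates. As \<open>D\<close> ignores the central coordinate, products may be replaced by
  sums in its argument, and the Leibniz rule turns into
  \<open>D (g + h) = D g + D h + (\<omega>(D g, h) + \<omega>(g, D h)) Z\<close>. The left-hand side is symmetric in \<open>g\<close> and \<open>h\<close> and
  the last term is antisymmetric, so the latter vanishes. Thus \<open>D\<close> is additive, hence linear, and
  infinitesimally symplectic; the second property makes the bracket with a right-invariant field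
  right-invariant again.
\<close>

lemma linear_vector_field_exp_coord:
  fixes X :: "'n::finite heis \<Rightarrow> 'n heis"
  assumes X: "linear_vector_field X"
    and center: "derivation X (field_at_one (c *\<^sub>R unit_Z)) = 0" "c \<noteq> 0"
  obtains D where "linear D" "D unit_Z = 0"
    "\<And>w. X (exp_coord w) = exp_coord_deriv w (D w)"
    "\<And>e. derivation X (field_at_one e) = field_at_one (D e)"
proof -
  have "X differentiable_on UNIV"
    using X unfolding linear_vector_field_def smooth_def by (metis Ck.simps(2))
  then have diff: "(X has_derivative frechet_derivative X (at g)) (at g)" for g
    unfolding differentiable_on_def frechet_derivative_works[symmetric] by blast
  have field_deriv: "frechet_derivative (field_at_one e) (at g) = (\<lambda>v. (0, 0, fst (snd e) \<bullet> fst v))"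
    for e g :: "'n heis"
    using has_derivative_field_at_one by (rule frechet_derivative_at[symmetric])
  have deriv: "derivation X (field_at_one e) g =
      frechet_derivative X (at g) (field_at_one e g) - (0, 0, fst (snd e) \<bullet> fst (X g))" for e g
    by (simp add: derivation_def lie_bracket_def field_deriv)
  have Xz: "X (x, y, z) = X (x, y, 0)" for x y z
  proof -
    have "((\<lambda>t. X (x, y, t)) has_derivative (\<lambda>h. 0)) (at t)" for t
    proof -
      have "frechet_derivative X (at (x, y, t)) (0, 0, c) = 0"
        using deriv[of "c *\<^sub>R unit_Z" "(x, y, t)"] center(1)
        by (simp add: field_at_one_apply flip: zero_prod_def)
      then have "frechet_derivative X (at (x, y, t)) (0, 0, h) = 0" for h
        using linear_scale[OF has_derivative_linear[OF diff], of "(x, y, t)" "h / c" "(0, 0, c)"] center(2)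
        by simp
      moreover have "((\<lambda>t. X (x, y, t)) has_derivative
          (\<lambda>h. frechet_derivative X (at (x, y, t)) (0, 0, h))) (at t)"
        by (rule has_derivative_compose[OF _ diff]) (auto intro!: derivative_eq_intros)
      ultimately show ?thesis
        by simp
    qed
    then show ?thesis
      by (intro has_derivative_zero_unique[of UNIV]) auto
  qed
  \<comment> \<open>The pullback of \<open>X\<close> along \<open>exp_coord\<close>: it may be evaluated at \<open>g\<close> because \<open>X (exp_coord g) = X g\<close>.\<close>
  define D where "D g = (fst (X g), fst (snd (X g)),
    snd (snd (X g)) - (fst (X g) \<bullet> fst (snd g) + fst (snd (X g)) \<bullet> fst g) / 2)" for g
  have X_eq: "X g = (fst (D g), fst (snd (D g)),
      snd (snd (D g)) + (fst (D g) \<bullet> fst (snd g) + fst (snd (D g)) \<bullet> fst g) / 2)" for g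
    by (simp add: D_def)
  have D_cong: "D g = D h" if "fst g = fst h" "fst (snd g) = fst (snd h)" for g h
  proof -
    have "X g = X h"
      using that by (cases g; cases h) (simp, metis Xz)
    then show ?thesis
      using that by (simp add: D_def)
  qed
  define \<sigma> where "\<sigma> g h = heis_omega (D g) h + heis_omega g (D h)" for g h
  have D_mult: "D (g + h) = D g + D h + \<sigma> g h *\<^sub>R unit_Z" for g h
  proof -
    have "D (g + h) = D (g \<odot> h)"
      by (rule D_cong) (simp_all add: heis_mult_def case_prod_unfold)
    then show ?thesis
      unfolding D_def linear_vector_field_mult[OF X, of g h] \<sigma>_def
      by (simp add: heis_mult_def case_prod_unfold heis_omega_def prod_eq_iff)
         (simp add: algebra_simps inner_commute add_divide_distrib diff_divide_distrib)
  qed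
  have \<sigma>0: "\<sigma> g h = 0" for g h
  proof -
    have "\<sigma> g h = \<sigma> h g"
      using D_mult[of g h] D_mult[of h g] by (simp add: add.commute prod_eq_iff)
    moreover have "\<sigma> g h = - \<sigma> h g"
      by (simp add: \<sigma>_def heis_omega_def inner_commute field_simps)
    ultimately show ?thesis by simp
  qed
  have D_add: "D (g + h) = D g + D h" for g h
    using D_mult[of g h] by (simp add: \<sigma>0 flip: zero_prod_def)
  \<comment> \<open>The witness is the unknown that the differentiation rules instantiate.\<close>
  have "\<exists>D'. (D has_derivative D') (at 0)"
    unfolding D_def by (rule exI) (auto intro!: derivative_eq_intros diff)
  then have lin: "linear D"
    using has_derivative_additive_imp_linear[of D] D_add by blast
  have DZ: "D unit_Z = 0"
    using D_cong[of unit_Z 0] linear_0[OF lin] by simp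
  have D_proj: "D g = D (fst g, fst (snd g), z)" for g z
    by (rule D_cong) simp_all
  have "X (exp_coord w) = exp_coord_deriv w (D w)" for w
    by (simp add: X_eq exp_coord_def exp_coord_deriv_def flip: D_proj) (simp add: inner_commute)
  moreover have "derivation X (field_at_one e) = field_at_one (D e)" for e
  proof
    fix g
    have bl: "(D has_derivative D) (at g)"
      using lin by (simp add: linear_conv_bounded_linear bounded_linear_imp_has_derivative)
    have "((\<lambda>g. (fst (D g), fst (snd (D g)),
        snd (snd (D g)) + (fst (D g) \<bullet> fst (snd g) + fst (snd (D g)) \<bullet> fst g) / 2)) has_derivative
        (\<lambda>v. (fst (D v), fst (snd (D v)), snd (snd (D v)) +
          (fst (D v) \<bullet> fst (snd g) + fst (D g) \<bullet> fst (snd v) +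
           fst (snd (D v)) \<bullet> fst g + fst (snd (D g)) \<bullet> fst v) / 2))) (at g)"
      by (auto intro!: derivative_eq_intros bl simp: fun_eq_iff)
    then have "frechet_derivative X (at g) = (\<lambda>v. (fst (D v), fst (snd (D v)), snd (snd (D v)) +
          (fst (D v) \<bullet> fst (snd g) + fst (D g) \<bullet> fst (snd v) +
           fst (snd (D v)) \<bullet> fst g + fst (snd (D g)) \<bullet> fst v) / 2))"
      by (simp flip: X_eq add: frechet_derivative_at[symmetric])
    moreover have "D (field_at_one e g) = D e"
      by (simp add: field_at_one_apply flip: D_proj)
    ultimately show "derivation X (field_at_one e) g = field_at_one (D e) g"
      using \<sigma>0[of e g]
      by (simp add: deriv X_eq[of g]) (simp add: field_at_one_apply \<sigma>_def heis_omega_def field_simps inner_commute)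
  qed
  ultimately show ?thesis
    using that lin DZ by blast
qed

lemma has_derivative_exp_coord: "(exp_coord has_derivative exp_coord_deriv w) (at w)"
  unfolding exp_coord_def[abs_def] exp_coord_deriv_def[abs_def]
  by (auto intro!: derivative_eq_intros simp: add_divide_distrib)

lemma linear_exp_coord_deriv: "linear (exp_coord_deriv w)"
  by (rule linearI) (auto simp: exp_coord_deriv_def inner_add_left inner_add_right algebra_simps add_divide_distrib)

lemma bounded_bilinear_heis_omega: "bounded_bilinear (heis_omega :: 'n::finite heis \<Rightarrow> _)"
  unfolding bilinear_conv_bounded_bilinear[symmetric] bilinear_def
  by (auto intro!: linearI simp: heis_omega_def inner_add_left inner_add_right field_simps)

text \<open>
  In exponential coordinates the product of \<open>t b\<close> and \<open>w\<close> is \<open>w + t (b + \<omega>(b, w) Z)\<close>, whose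
  derivative at \<open>t = 0\<close> is the right-invariant field with value \<open>b\<close> at the identity.
\<close>

lemma exp_coord_deriv_field_at_one:
  "exp_coord_deriv w (b + heis_omega b w *\<^sub>R unit_Z) = field_at_one b (exp_coord w)"
  by (simp add: exp_coord_deriv_def heis_omega_def field_at_one_apply exp_coord_def inner_commute field_simps)

lemma heis_omega_alt: "heis_omega v v = 0"
  by (simp add: heis_omega_def inner_commute)

section \<open>Polynomial solutions of linear control systems\<close>

lemma span_image_lessThan:
  fixes f :: "nat \<Rightarrow> 'e::real_vector"
  assumes "x \<in> span (f ` {..<n})"
  shows "\<exists>c. x = (\<Sum>k<n. c k *\<^sub>R f k)"
  using assms
proof (induction n arbitrary: x)
  case (Suc n)
  then obtain a where "x - a *\<^sub>R f n \<in> span (f ` {..<n})"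
    by (auto simp: lessThan_Suc span_insert)
  then obtain c where c: "x - a *\<^sub>R f n = (\<Sum>k<n. c k *\<^sub>R f k)"
    using Suc.IH by blast
  have "x = (\<Sum>k<Suc n. (c(n := a)) k *\<^sub>R f k)"
    using c by (simp add: algebra_simps)
  then show ?case by blast
qed simp

text \<open>
  If no term were in the span of its predecessors, arbitrarily many terms would be linearly
  independent. Applied to \<open>b, D b, D\<^sup>2 b, \<dots>\<close>, the lemma gives a monic polynomial in \<open>D\<close> that annihilates
  \<open>b\<close>.
\<close>

lemma sequence_linear_recurrence:
  fixes f :: "nat \<Rightarrow> 'e::euclidean_space"
  obtains r c where "f r = (\<Sum>k<r. c k *\<^sub>R f k)"
proof -
  have "\<exists>r. f r \<in> span (f ` {..<r})"
  proof (rule ccontr)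
    assume "\<nexists>r. f r \<in> span (f ` {..<r})"
    then have new: "f r \<notin> span (f ` {..<r})" for r
      by blast
    have "independent (f ` {..<n}) \<and> card (f ` {..<n}) = n" for n
    proof (induction n)
      case (Suc n)
      have "independent (insert (f n) (f ` {..<n}))"
        using Suc new[of n] by (intro independent_insertI) auto
      moreover have "f n \<notin> f ` {..<n}"
        using new[of n] span_base[of "f n" "f ` {..<n}"] by blast
      then have "card (insert (f n) (f ` {..<n})) = Suc n"
        using Suc by (subst card_insert_disjoint) auto
      ultimately show ?case
        unfolding lessThan_Suc image_insert by simp
    qed (simp add: independent_empty)
    then have "independent (f ` {..<Suc DIM('e)})" "card (f ` {..<Suc DIM('e)}) = Suc DIM('e)"
      by blast+
    then show False
      using independent_bound[of "f ` {..<Suc DIM('e)}"] by linarith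
  qed
  then show ?thesis
    using that span_image_lessThan by blast
qed

text \<open>
  Arcs are required to solve the equation on the whole real line, which makes them stable under
  translation and reversal of time; the time interval of interest is always \<open>[0, 1]\<close>.
\<close>

definition linear_arc ::
    "('e \<Rightarrow> 'e) \<Rightarrow> ('m::finite \<Rightarrow> 'e) \<Rightarrow> (real \<Rightarrow> 'e::real_normed_vector) \<Rightarrow> (real \<Rightarrow> real ^ 'm) \<Rightarrow> bool"
  where "linear_arc D B w u \<longleftrightarrow> continuous_on UNIV u \<and>
    (\<forall>t. (w has_vector_derivative D (w t) + (\<Sum>j\<in>UNIV. u t $ j *\<^sub>R B j)) (at t))"

lemma linear_arc_add:
  assumes "linear D" "linear_arc D B w u" "linear_arc D B w' u'"
  shows "linear_arc D B (\<lambda>t. w t + w' t) (\<lambda>t. u t + u' t)"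
  using assms unfolding linear_arc_def
  by (auto intro!: continuous_intros derivative_eq_intros
      simp: linear_add scaleR_add_left sum.distrib)

lemma linear_arc_scale:
  assumes "linear D" "linear_arc D B w u"
  shows "linear_arc D B (\<lambda>t. s *\<^sub>R w t) (\<lambda>t. s *\<^sub>R u t)"
  using assms unfolding linear_arc_def
  by (auto intro!: continuous_intros derivative_eq_intros
      simp: linear_scale scaleR_add_right scaleR_sum_right)

text \<open>
  Reversing time changes the sign of the drift, so steering from the origin follows from
  steering to the origin for \<open>- D\<close>.
\<close>

lemma linear_arc_reverse:
  assumes "linear_arc (\<lambda>x. - D x) B w u"
  shows "linear_arc D B (\<lambda>t. w (1 - t)) (\<lambda>t. - u (1 - t))"
proof -
  have u: "continuous_on UNIV u" and
    w: "(w has_vector_derivative - D (w t) + (\<Sum>j\<in>UNIV. u t $ j *\<^sub>R B j)) (at t)" for t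
    using assms unfolding linear_arc_def by auto
  have "((w \<circ> (\<lambda>t. 1 - t)) has_vector_derivative
      (- 1) *\<^sub>R (- D (w (1 - t)) + (\<Sum>j\<in>UNIV. u (1 - t) $ j *\<^sub>R B j))) (at t)" for t
    by (rule vector_diff_chain_at[OF _ w]) (auto intro!: derivative_eq_intros)
  moreover have "continuous_on UNIV (\<lambda>t. - u (1 - t))"
    by (intro continuous_intros continuous_on_compose2[OF u]) auto
  ultimately show ?thesis
    by (simp add: linear_arc_def o_def sum_negf)
qed

text \<open>
  Let \<open>D\<^sup>r b = \<Sum>\<^sub>k\<^sub><\<^sub>r c\<^sub>k D\<^sup>k b\<close>. To solve \<open>w' = \<epsilon> D w + u b\<close>, try
  \<open>w = \<Sum>\<^sub>j\<^sub><\<^sub>r \<rho>\<^sub>j (\<epsilon> D)\<^sup>r\<^sup>-\<^sup>1\<^sup>-\<^sup>j b\<close>. Comparing coefficients requires \<open>\<rho>\<^sub>j\<^sub>+\<^sub>1 = \<rho>\<^sub>j' - \<epsilon>\<^sup>j\<^sup>+\<^sup>1 c\<^sub>r\<^sub>-\<^sub>1\<^sub>-\<^sub>j \<rho>\<^sub>0\<close> and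
  \<open>u = \<rho>\<^sub>r\<close>, while \<open>\<psi> = \<rho>\<^sub>0\<close> is free: it is a flat output, through which state and control are
  expressed without integration. The sum is this recursion in closed form, which shows that \<open>\<rho>\<^sub>j\<close>
  involves only derivatives of \<open>\<psi>\<close> up to order \<open>j\<close> and depends polynomially on \<open>\<epsilon>\<close>.
\<close>

definition flat_poly :: "(nat \<Rightarrow> real) \<Rightarrow> nat \<Rightarrow> real \<Rightarrow> real poly \<Rightarrow> nat \<Rightarrow> real poly" where
  "flat_poly c r \<epsilon> \<psi> j = (pderiv ^^ j) \<psi> -
     (\<Sum>i<j. smult (\<epsilon> ^ Suc i * c (r - Suc i)) ((pderiv ^^ (j - Suc i)) \<psi>))"

lemma poly_flat_poly:
  "poly (flat_poly c r \<epsilon> \<psi> j) t = poly ((pderiv ^^ j) \<psi>) t -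
     (\<Sum>i<j. \<epsilon> ^ Suc i * c (r - Suc i) * poly ((pderiv ^^ (j - Suc i)) \<psi>) t)"
  by (simp add: flat_poly_def poly_sum)

lemma pderiv_flat_poly:
  "pderiv (flat_poly c r \<epsilon> \<psi> j) =
     flat_poly c r \<epsilon> \<psi> (Suc j) + smult (\<epsilon> ^ Suc j * c (r - Suc j)) \<psi>"
proof -
  have "pderiv ((pderiv ^^ (j - Suc i)) \<psi>) = (pderiv ^^ (j - i)) \<psi>" if "i < j" for i
    using that by (simp flip: funpow.simps(2)[unfolded o_def, THEN fun_cong] add: Suc_diff_Suc)
  then show ?thesis
    by (simp add: flat_poly_def pderiv_diff pderiv_smult higher_pderiv_sum[of 1, simplified])
qed

definition flat_arc ::
    "('e \<Rightarrow> 'e) \<Rightarrow> 'e \<Rightarrow> (nat \<Rightarrow> real) \<Rightarrow> nat \<Rightarrow> real \<Rightarrow> real poly \<Rightarrow> real \<Rightarrow> 'e::real_normed_vector" where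
  "flat_arc D b c r \<epsilon> \<psi> t =
     (\<Sum>j<r. (poly (flat_poly c r \<epsilon> \<psi> j) t * \<epsilon> ^ (r - Suc j)) *\<^sub>R (D ^^ (r - Suc j)) b)"

text \<open>
  The recursion for \<open>flat_poly\<close> makes the sum telescope; what remains at the upper end is
  \<open>\<psi> (\<epsilon> D)\<^sup>r b\<close>, which the relation between the \<open>D\<^sup>k b\<close> cancels.
\<close>

lemma has_vector_derivative_flat_arc:
  fixes D :: "'e::real_normed_vector \<Rightarrow> 'e"
  assumes lin: "linear D" and rec: "(D ^^ r) b = (\<Sum>k<r. c k *\<^sub>R (D ^^ k) b)"
  shows "(flat_arc D b c r \<epsilon> \<psi> has_vector_derivative
    \<epsilon> *\<^sub>R D (flat_arc D b c r \<epsilon> \<psi> t) + poly (flat_poly c r \<epsilon> \<psi> r) t *\<^sub>R b) (at t)"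
proof -
  define p where "p j = poly (flat_poly c r \<epsilon> \<psi> j) t" for j
  define e where "e k = \<epsilon> ^ k *\<^sub>R (D ^^ k) b" for k
  have De: "e (r - j) = \<epsilon> *\<^sub>R D (e (r - Suc j))" if "j < r" for j
  proof -
    have "r - j = Suc (r - Suc j)"
      using that by simp
    then show ?thesis
      using lin by (simp add: e_def linear_scale)
  qed
  have arc: "flat_arc D b c r \<epsilon> \<psi> t = (\<Sum>j<r. p j *\<^sub>R e (r - Suc j))"
    by (simp add: flat_arc_def p_def e_def)
  have "e r = (\<Sum>k<r. (\<epsilon> ^ (r - k) * c k) *\<^sub>R e k)"
    unfolding e_def rec scaleR_sum_right
    by (intro sum.cong refl) (simp add: power_add[symmetric] mult.commute mult.left_commute)
  also have "\<dots> = (\<Sum>j<r. (\<epsilon> ^ Suc j * c (r - Suc j)) *\<^sub>R e (r - Suc j))"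
    by (rule sum.nat_diff_reindex[symmetric, THEN trans]) (auto intro!: sum.cong simp: Suc_diff_Suc)
  finally have er: "e r = \<dots>" .
  have "(flat_arc D b c r \<epsilon> \<psi> has_vector_derivative
      (\<Sum>j<r. (poly (pderiv (flat_poly c r \<epsilon> \<psi> j)) t * \<epsilon> ^ (r - Suc j)) *\<^sub>R (D ^^ (r - Suc j)) b)) (at t)"
    unfolding flat_arc_def has_vector_derivative_def
    by (auto intro!: derivative_eq_intros poly_DERIV[THEN has_field_derivative_imp_has_derivative] sum.cong
        simp: scaleR_sum_right)
  moreover have "(\<Sum>j<r. (poly (pderiv (flat_poly c r \<epsilon> \<psi> j)) t * \<epsilon> ^ (r - Suc j)) *\<^sub>R (D ^^ (r - Suc j)) b)
      = (\<Sum>j<r. p (Suc j) *\<^sub>R e (r - Suc j)) + poly \<psi> t *\<^sub>R e r"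
    unfolding er pderiv_flat_poly
    by (simp add: p_def e_def scaleR_sum_right algebra_simps flip: sum.distrib)
  moreover have "(\<Sum>j<r. p (Suc j) *\<^sub>R e (r - Suc j)) + p 0 *\<^sub>R e r
      = (\<Sum>j<r. p j *\<^sub>R e (r - j)) + p r *\<^sub>R e 0"
    using sum.lessThan_Suc_shift[of "\<lambda>j. p j *\<^sub>R e (r - j)" r] by (simp add: add.commute)
  moreover have "\<epsilon> *\<^sub>R D (flat_arc D b c r \<epsilon> \<psi> t) = (\<Sum>j<r. p j *\<^sub>R e (r - j))"
    unfolding arc using lin
    by (auto simp: linear_sum linear_scale scaleR_sum_right De mult.commute intro!: sum.cong)
  ultimately show ?thesis
    by (simp add: p_def flat_poly_def e_def)
qed

lemma linear_arc_flat_arc: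
  fixes D :: "'e::real_normed_vector \<Rightarrow> 'e" and B :: "'m::finite \<Rightarrow> 'e"
  assumes "linear D" and "(D ^^ r) (B i) = (\<Sum>k<r. c k *\<^sub>R (D ^^ k) (B i))"
  shows "linear_arc (\<lambda>x. \<epsilon> *\<^sub>R D x) B (flat_arc D (B i) c r \<epsilon> \<psi>)
    (\<lambda>t. poly (flat_poly c r \<epsilon> \<psi> r) t *\<^sub>R axis i 1)"
proof -
  have "(\<Sum>j\<in>UNIV. (x *\<^sub>R axis i 1 :: real ^ 'm) $ j *\<^sub>R B j) = x *\<^sub>R B i" for x
    by (simp add: axis_def if_distrib[of "\<lambda>x. _ * x"] if_distrib[of "\<lambda>x. x *\<^sub>R _"] cong: if_cong)
  then show ?thesis
    unfolding linear_arc_def using has_vector_derivative_flat_arc[OF assms]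
    by (auto intro!: continuous_intros)
qed

lemma higher_pderiv_vanish:
  fixes \<psi> :: "real poly"
  assumes "[:- a, 1:] ^ N dvd \<psi>" "j < N"
  shows "poly ((pderiv ^^ j) \<psi>) a = 0"
proof -
  have "[:- a, 1:] ^ (N - j) dvd (pderiv ^^ j) \<psi>" for j
  proof (induction j)
    case (Suc j)
    show ?case
    proof (cases "N - j")
      case (Suc n)
      then obtain q where "(pderiv ^^ j) \<psi> = [:- a, 1:] ^ Suc n * q"
        using Suc.IH by auto
      then have "(pderiv ^^ Suc j) \<psi> = pderiv ([:- a, 1:] ^ Suc n * q)"
        by simp
      also have "\<dots> = [:- a, 1:] ^ n * (smult (of_nat (Suc n)) q + [:- a, 1:] * pderiv q)"
        unfolding pderiv_mult pderiv_power_Suc by (simp add: pderiv_pCons algebra_simps)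
      finally have "[:- a, 1:] ^ n dvd (pderiv ^^ Suc j) \<psi>"
        by simp
      moreover have "N - Suc j = n"
        using Suc by simp
      ultimately show ?thesis by simp
    qed simp
  qed (use assms in simp)
  from this[of j] have "[:- a, 1:] dvd (pderiv ^^ j) \<psi>"
    using \<open>j < N\<close> by (metis dvd_power dvd_trans zero_less_diff)
  then show ?thesis
    by (simp add: poly_eq_0_iff_dvd)
qed

lemma flat_poly_vanish:
  assumes "\<And>i. i \<le> j \<Longrightarrow> poly ((pderiv ^^ i) \<psi>) a = 0"
  shows "poly (flat_poly c r \<epsilon> \<psi> j) a = 0"
  using assms by (simp add: poly_flat_poly)

lemma flat_arc_vanish:
  assumes "\<And>i. i < r \<Longrightarrow> poly ((pderiv ^^ i) \<psi>) a = 0"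
  shows "flat_arc D b c r \<epsilon> \<psi> a = 0"
  unfolding flat_arc_def by (intro sum.neutral) (simp add: flat_poly_vanish assms)

lemma linear_funpow:
  fixes D :: "'e::real_vector \<Rightarrow> 'e"
  assumes "linear D"
  shows "linear (D ^^ k)"
proof (induction k)
  case (Suc k)
  then show ?case
    using linear_compose[OF Suc assms] by (simp add: o_def)
qed (simp add: linear_ident)

text \<open>
  Kalman's criterion. The points that can be steered to the origin form a subspace, so it is enough
  that it contains every \<open>D\<^sup>n b\<^sub>i\<close>, by induction on \<open>n\<close>. For \<open>n \<ge> r\<close> the annihilating relation expresses it by
  earlier ones. For \<open>n < r\<close> take the flat output \<open>\<psi> = t\<^sup>k (t - 1)\<^sup>r\<close> with \<open>k = r - 1 - n\<close>: it vanishes to order \<open>r\<close>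
  at \<open>1\<close>, so the arc ends at the origin, and to order exactly \<open>k\<close> at \<open>0\<close>, so the arc starts at a
  nonzero multiple of \<open>D\<^sup>n b\<^sub>i\<close> plus a combination of lower powers.
\<close>

lemma kalman_steer_to_zero:
  fixes D :: "'e::euclidean_space \<Rightarrow> 'e" and B :: "'m::finite \<Rightarrow> 'e"
  assumes lin: "linear D" and x: "x \<in> span {(D ^^ k) (B i) | k i. True}"
  obtains w u where "linear_arc D B w u" "w 0 = x" "w 1 = 0"
proof -
  define S where "S = {x. \<exists>w u. linear_arc D B w u \<and> w 0 = x \<and> w 1 = 0}"
  have "linear_arc D B (\<lambda>t. 0) (\<lambda>t. 0)"
    using lin by (simp add: linear_arc_def linear_0)
  then have S: "subspace S"
  proof -
    have "x + y \<in> S" if x: "x \<in> S" and y: "y \<in> S" for x y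
    proof -
      obtain w u w' u' where "linear_arc D B w u" "w 0 = x" "w 1 = 0"
        "linear_arc D B w' u'" "w' 0 = y" "w' 1 = 0"
        using x y unfolding S_def by blast
      then show ?thesis
        using linear_arc_add[OF lin, of B w u w' u'] unfolding S_def by force
    qed
    moreover have "s *\<^sub>R x \<in> S" if x: "x \<in> S" for s x
    proof -
      obtain w u where "linear_arc D B w u" "w 0 = x" "w 1 = 0"
        using x unfolding S_def by blast
      then show ?thesis
        using linear_arc_scale[OF lin, of B w u s] unfolding S_def by force
    qed
    ultimately show ?thesis
      using \<open>linear_arc D B (\<lambda>t. 0) (\<lambda>t. 0)\<close> unfolding subspace_def S_def by force
  qed
  have gen: "(D ^^ n) (B i) \<in> S" for n i
  proof -
    obtain r c where rec: "(D ^^ r) (B i) = (\<Sum>k<r. c k *\<^sub>R (D ^^ k) (B i))"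
      using sequence_linear_recurrence[of "\<lambda>k. (D ^^ k) (B i)"] by blast
    show ?thesis
    proof (induction n rule: less_induct)
      case (less n)
      show ?case
      proof (cases "n < r")
        case False
        have "(D ^^ n) (B i) = (D ^^ (n - r)) ((D ^^ r) (B i))"
          using False by (simp flip: funpow_add[THEN fun_cong, unfolded o_def])
        also have "\<dots> = (\<Sum>k<r. c k *\<^sub>R (D ^^ (n - r + k)) (B i))"
          unfolding rec using linear_funpow[OF lin, of "n - r"]
          by (simp add: linear_sum linear_scale funpow_add)
        also have "\<dots> \<in> S"
          using False by (intro subspace_sum[OF S] subspace_scale[OF S] less) auto
        finally show ?thesis .
      next
        case True
        define k where "k = r - Suc n"
        define \<psi> :: "real poly" where "\<psi> = monom 1 k * [:- 1, 1:] ^ r"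
        define w where "w = flat_arc D (B i) c r 1 \<psi>"
        define p where "p j = poly (flat_poly c r 1 \<psi> j) 0" for j
        have jet: "poly ((pderiv ^^ j) \<psi>) 0 = fact j * coeff \<psi> j" for j
          by (simp add: poly_0_coeff_0 coeff_higher_pderiv pochhammer_fact)
        have jet0: "poly ((pderiv ^^ j) \<psi>) 0 = 0" if "j < k" for j
          using that unfolding jet by (simp add: \<psi>_def coeff_monom_mult)
        have "coeff ([:- 1, 1:] ^ r) 0 = (- 1 :: real) ^ r"
          by (simp flip: poly_0_coeff_0)
        then have "poly ((pderiv ^^ k) \<psi>) 0 \<noteq> 0"
          unfolding jet by (simp add: \<psi>_def coeff_monom_mult)
        moreover have "p k = poly ((pderiv ^^ k) \<psi>) 0"
          by (simp add: p_def poly_flat_poly jet0)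
        ultimately have pk: "p k \<noteq> 0"
          by simp
        have "w 1 = 0"
          unfolding w_def by (intro flat_arc_vanish higher_pderiv_vanish[of _ r]) (auto simp: \<psi>_def)
        then have w0: "w 0 \<in> S"
          using linear_arc_flat_arc[OF lin, of r B i c 1 \<psi>] rec unfolding S_def w_def by auto
        have "{..<r} = {..<k} \<union> insert k {k<..<r}"
          using True by (auto simp: k_def)
        then have "w 0 = (\<Sum>j\<in>{..<k} \<union> insert k {k<..<r}. p j *\<^sub>R (D ^^ (r - Suc j)) (B i))"
          by (simp add: w_def flat_arc_def p_def)
        also have "\<dots> = (\<Sum>j<k. p j *\<^sub>R (D ^^ (r - Suc j)) (B i)) + (p k *\<^sub>R (D ^^ (r - Suc k)) (B i)
            + (\<Sum>j\<in>{k<..<r}. p j *\<^sub>R (D ^^ (r - Suc j)) (B i)))"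
          by (subst sum.union_disjoint) auto
        also have "(\<Sum>j<k. p j *\<^sub>R (D ^^ (r - Suc j)) (B i)) = 0"
          by (intro sum.neutral) (auto simp: p_def flat_poly_vanish jet0)
        also have "r - Suc k = n"
          using True by (simp add: k_def)
        finally have "p k *\<^sub>R (D ^^ n) (B i) = w 0 - (\<Sum>j\<in>{k<..<r}. p j *\<^sub>R (D ^^ (r - Suc j)) (B i))"
          by simp
        moreover have "(\<Sum>j\<in>{k<..<r}. p j *\<^sub>R (D ^^ (r - Suc j)) (B i)) \<in> S"
          by (intro subspace_sum[OF S] subspace_scale[OF S] less) (use True in \<open>auto simp: k_def\<close>)
        ultimately have "p k *\<^sub>R (D ^^ n) (B i) \<in> S"
          using w0 subspace_diff[OF S] by simp
        then have "(1 / p k) *\<^sub>R (p k *\<^sub>R (D ^^ n) (B i)) \<in> S"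
          by (rule subspace_scale[OF S])
        then show ?thesis
          using pk by simp
      qed
    qed
  qed
  have "span {(D ^^ k) (B i) | k i. True} \<subseteq> S"
    using gen S by (intro span_minimal) auto
  then show ?thesis
    using x that unfolding S_def by blast
qed

lemma kalman_steer_from_zero:
  fixes D :: "'e::euclidean_space \<Rightarrow> 'e" and B :: "'m::finite \<Rightarrow> 'e"
  assumes lin: "linear D" and x: "x \<in> span {(D ^^ k) (B i) | k i. True}"
  obtains w u where "linear_arc D B w u" "w 0 = 0" "w 1 = x"
proof -
  let ?D = "\<lambda>x. - D x"
  have lin': "linear ?D"
    using lin by (intro linear_compose_neg)
  have pow: "(?D ^^ k) b = (- 1) ^ k *\<^sub>R (D ^^ k) b" for k b
    using lin by (induction k) (auto simp: linear_scale linear_neg)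
  have "(D ^^ k) (B i) \<in> span {(?D ^^ k) (B i) | k i. True}" for k i
  proof -
    have "(- 1) ^ k *\<^sub>R (?D ^^ k) (B i) \<in> span {(?D ^^ k) (B i) | k i. True}"
      by (intro span_scale span_base) blast
    then show ?thesis
      by (simp add: pow flip: power_mult_distrib)
  qed
  then have "span {(D ^^ k) (B i) | k i. True} \<subseteq> span {(?D ^^ k) (B i) | k i. True}"
    by (intro span_minimal) (auto simp: subspace_span)
  then obtain w u where "linear_arc ?D B w u" "w 0 = x" "w 1 = 0"
    using x kalman_steer_to_zero[OF lin'] by blast
  then show ?thesis
    using that[OF linear_arc_reverse] by force
qed

section \<open>Loops enclosing a prescribed sign of area\<close>

lemma higher_pderiv_eq_0_imp_degree:
  fixes p :: "real poly"
  assumes "(pderiv ^^ n) p = 0" "p \<noteq> 0"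
  shows "degree p < n"
proof (rule ccontr)
  assume "\<not> degree p < n"
  then have "coeff ((pderiv ^^ n) p) (degree p - n) =
      pochhammer (of_nat (Suc (degree p - n))) n * lead_coeff p"
    by (simp add: coeff_higher_pderiv)
  moreover have "pochhammer (of_nat (Suc (degree p - n)) :: real) n > 0"
    by (rule pochhammer_pos) simp
  ultimately show False
    using assms by simp
qed

lemma integral_poly_pos:
  fixes p :: "real poly"
  assumes "p \<noteq> 0"
  shows "integral {0..1} (\<lambda>t. (poly p t)\<^sup>2) > 0"
proof -
  have cont: "continuous_on {0..1} (\<lambda>t. (poly p t)\<^sup>2)"
    by (intro continuous_intros)
  have "integral {0..1} (\<lambda>t. (poly p t)\<^sup>2) \<noteq> 0"
  proof
    assume "integral {0..1} (\<lambda>t. (poly p t)\<^sup>2) = 0"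
    then have "\<forall>t\<in>{0..1}. (poly p t)\<^sup>2 = 0"
      using integral_eq_0_iff[OF cont] by simp
    then have "{0..1} \<subseteq> {t. poly p t = 0}"
      by auto
    then have "finite {0..1 :: real}"
      using poly_roots_finite[OF assms] finite_subset by blast
    then show False
      using infinite_Icc[of "0 :: real" 1] by simp
  qed
  moreover have "integral {0..1} (\<lambda>t. (poly p t)\<^sup>2) \<ge> 0"
    by (intro integral_nonneg integrable_continuous_real cont) simp
  ultimately show ?thesis by simp
qed

lemma flat_arc_at_0:
  assumes "r > 0"
  shows "flat_arc D b c r 0 \<psi> t = poly ((pderiv ^^ (r - 1)) \<psi>) t *\<^sub>R b"
proof -
  obtain n where r: "r = Suc n"
    using assms by (cases r) auto
  have "flat_arc D b c r 0 \<psi> t = (\<Sum>j<r. if j = n then poly ((pderiv ^^ n) \<psi>) t *\<^sub>R b else 0)"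
    unfolding flat_arc_def by (intro sum.cong) (auto simp: r poly_flat_poly zero_power)
  then show ?thesis
    by (simp add: r)
qed

lemma continuous_on_flat_poly [continuous_intros]:
  assumes "continuous_on S f" "continuous_on S g"
  shows "continuous_on S (\<lambda>x. poly (flat_poly c r (f x) \<psi> j) (g x))"
  unfolding poly_flat_poly by (intro continuous_intros assms)

lemma continuous_on_flat_arc [continuous_intros]:
  assumes "continuous_on S f" "continuous_on S g"
  shows "continuous_on S (\<lambda>x. flat_arc D b c r (f x) \<psi> (g x))"
  unfolding flat_arc_def by (intro continuous_intros assms)

text \<open>
  Superpose the flat arcs of \<open>B i\<close> and \<open>B j\<close> whose flat outputs are derivatives of
  \<open>\<eta> = t\<^sup>N (t - 1)\<^sup>N\<close>; the order of vanishing of \<open>\<eta>\<close> closes the loop at the origin for every speed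
  \<open>\<epsilon>\<close> of the drift. The area is continuous in \<open>\<epsilon>\<close>, so it is enough to find its sign at \<open>\<epsilon> = 0\<close>. The
  outputs are differentiated so often that the driftless loop is \<open>p B\<^sub>i + p' B\<^sub>j\<close> for one polynomial
  \<open>p\<close>. Its area is \<open>\<integral> (p'\<^sup>2 - p p'') = 2 \<integral> p'\<^sup>2\<close> times \<open>\<omega>(B\<^sub>i, B\<^sub>j)\<close>.
\<close>

lemma exists_loop_with_signed_area:
  fixes D :: "'e::euclidean_space \<Rightarrow> 'e" and B :: "'m::finite \<Rightarrow> 'e" and \<omega> :: "'e \<Rightarrow> 'e \<Rightarrow> real"
  assumes lin: "linear D" and bilin: "bounded_bilinear \<omega>" and alt: "\<And>v. \<omega> v v = 0"
    and ij: "\<omega> (B i) (B j) \<noteq> 0"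
  obtains \<epsilon> w u where "\<epsilon> > 0" "linear_arc (\<lambda>x. \<epsilon> *\<^sub>R D x) B w u" "w 0 = 0" "w 1 = 0"
    "0 < \<omega> (B i) (B j) * integral {0..1} (\<lambda>t. \<omega> (\<Sum>k\<in>UNIV. u t $ k *\<^sub>R B k) (w t))"
proof -
  interpret \<omega>: bounded_bilinear \<omega> by (rule bilin)
  obtain r c where rec: "(D ^^ r) (B i) = (\<Sum>k<r. c k *\<^sub>R (D ^^ k) (B i))"
    using sequence_linear_recurrence[of "\<lambda>k. (D ^^ k) (B i)"] by blast
  obtain r' c' where rec': "(D ^^ r') (B j) = (\<Sum>k<r'. c' k *\<^sub>R (D ^^ k) (B j))"
    using sequence_linear_recurrence[of "\<lambda>k. (D ^^ k) (B j)"] by blast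
  have r: "r > 0" "r' > 0"
    using ij rec rec' by (auto intro!: gr0I simp: \<omega>.zero_left \<omega>.zero_right)
  \<comment> \<open>The factor \<open>t\<close> is written \<open>t - 0\<close> so that both end points are treated by the same lemma.\<close>
  define \<eta> :: "real poly" where "\<eta> = [:- 0, 1:] ^ (r + r') * [:- 1, 1:] ^ (r + r')"
  define p where "p = (pderiv ^^ (r + r' - 2)) \<eta>"
  define \<psi> where "\<psi> = (pderiv ^^ (r' - 1)) \<eta>"
  define \<psi>' where "\<psi>' = (pderiv ^^ r) \<eta>"
  define U where "U \<epsilon> t = poly (flat_poly c r \<epsilon> \<psi> r) t *\<^sub>R axis i 1 +
    poly (flat_poly c' r' \<epsilon> \<psi>' r') t *\<^sub>R (axis j 1 :: real ^ 'm)" for \<epsilon> t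
  define W where "W \<epsilon> t = flat_arc D (B i) c r \<epsilon> \<psi> t + flat_arc D (B j) c' r' \<epsilon> \<psi>' t" for \<epsilon> t
  have arc: "linear_arc (\<lambda>x. \<epsilon> *\<^sub>R D x) B (W \<epsilon>) (U \<epsilon>)" for \<epsilon>
    unfolding W_def U_def
    by (intro linear_arc_add linear_compose_scale_right linear_arc_flat_arc lin rec rec')
  have \<eta>_vanish: "poly ((pderiv ^^ k) \<eta>) a = 0" if "a = 0 \<or> a = 1" "k < r + r'" for k a
    using that by (auto intro!: higher_pderiv_vanish[of _ "r + r'"] simp: \<eta>_def)
  have loop: "W \<epsilon> a = 0" if "a = 0 \<or> a = 1" for \<epsilon> a
  proof -
    have "flat_arc D (B i) c r \<epsilon> \<psi> a = 0"
      unfolding \<psi>_def by (intro flat_arc_vanish)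
        (use that r in \<open>auto simp flip: funpow_add[THEN fun_cong, unfolded o_def] intro!: \<eta>_vanish\<close>)
    moreover have "flat_arc D (B j) c' r' \<epsilon> \<psi>' a = 0"
      unfolding \<psi>'_def by (intro flat_arc_vanish)
        (use that r in \<open>auto simp flip: funpow_add[THEN fun_cong, unfolded o_def] intro!: \<eta>_vanish\<close>)
    ultimately show ?thesis
      by (simp add: W_def)
  qed
  have control: "(\<Sum>k\<in>UNIV. U \<epsilon> t $ k *\<^sub>R B k) =
      poly (flat_poly c r \<epsilon> \<psi> r) t *\<^sub>R B i + poly (flat_poly c' r' \<epsilon> \<psi>' r') t *\<^sub>R B j" for \<epsilon> t
    by (simp add: U_def axis_def scaleR_add_left sum.distrib if_distrib[of "\<lambda>x. _ * x"]
        if_distrib[of "\<lambda>x. x *\<^sub>R _"] cong: if_cong)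
  define Q where "Q \<epsilon> = integral {0..1} (\<lambda>t. \<omega> (\<Sum>k\<in>UNIV. U \<epsilon> t $ k *\<^sub>R B k) (W \<epsilon> t))" for \<epsilon>
  have "continuous_on UNIV Q"
  proof -
    have "continuous_on (UNIV \<times> cbox 0 1)
        (\<lambda>(\<epsilon>, t). \<omega> (\<Sum>k\<in>UNIV. U \<epsilon> t $ k *\<^sub>R B k) (W \<epsilon> t))"
      unfolding control W_def case_prod_unfold
      by (intro continuous_intros \<omega>.continuous_on)
    then have "continuous_on UNIV (\<lambda>\<epsilon>. integral (cbox 0 1) (\<lambda>t. \<omega> (\<Sum>k\<in>UNIV. U \<epsilon> t $ k *\<^sub>R B k) (W \<epsilon> t)))"
      by (rule integral_continuous_on_param)
    then show ?thesis
      unfolding Q_def cbox_interval .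
  qed
  moreover have "Q 0 * \<omega> (B i) (B j) > 0"
  proof -
    let ?p' = "pderiv p" and ?p'' = "pderiv (pderiv p)"
    have comp: "(pderiv ^^ k) ((pderiv ^^ l) \<eta>) = (pderiv ^^ (k + l)) \<eta>" for k l
      by (simp add: funpow_add)
    have idx: "r - 1 + (r' - 1) = r + r' - 2" "r + (r' - 1) = Suc (r + r' - 2)"
      "r' - 1 + r = Suc (r + r' - 2)" "r' + r = Suc (Suc (r + r' - 2))"
      using r by auto
    have jets: "(pderiv ^^ (r - 1)) \<psi> = p" "(pderiv ^^ r) \<psi> = ?p'"
      "(pderiv ^^ (r' - 1)) \<psi>' = ?p'" "(pderiv ^^ r') \<psi>' = ?p''"
      unfolding \<psi>_def \<psi>'_def p_def comp idx by simp_all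
    have flat0: "flat_poly a k 0 q k = (pderiv ^^ k) q" for a k q
      by (simp add: flat_poly_def)
    have integrand: "\<omega> (\<Sum>k\<in>UNIV. U 0 t $ k *\<^sub>R B k) (W 0 t) =
        (2 * (poly ?p' t)\<^sup>2 - poly (pderiv (p * ?p')) t) * \<omega> (B i) (B j)" for t
    proof -
      have anti: "\<omega> (B j) (B i) = - \<omega> (B i) (B j)"
        using alt[of "B i + B j"] alt[of "B i"] alt[of "B j"] by (simp add: \<omega>.add_left \<omega>.add_right)
      show ?thesis
        unfolding control W_def flat_arc_at_0[OF r(1)] flat_arc_at_0[OF r(2)] flat0 jets
        by (simp add: \<omega>.add_left \<omega>.add_right \<omega>.scaleR_left \<omega>.scaleR_right alt anti pderiv_mult
            power2_eq_square algebra_simps)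
    qed
    have "((\<lambda>t. poly (pderiv (p * ?p')) t) has_integral poly (p * ?p') 1 - poly (p * ?p') 0) {0..1}"
      by (intro fundamental_theorem_of_calculus zero_le_one)
         (simp add: has_field_derivative_at_within del: poly_mult
           flip: has_real_derivative_iff_has_vector_derivative)
    moreover have "poly p 1 = 0" "poly p 0 = 0"
      unfolding p_def using r by (auto intro!: \<eta>_vanish)
    ultimately have exact: "((\<lambda>t. poly (pderiv (p * ?p')) t) has_integral 0) {0..1}"
      by simp
    have sq: "((\<lambda>t. (poly ?p' t)\<^sup>2) has_integral integral {0..1} (\<lambda>t. (poly ?p' t)\<^sup>2)) {0..1}"
      by (intro integrable_integral integrable_continuous_real continuous_intros)
    have "Q 0 = (2 * integral {0..1} (\<lambda>t. (poly ?p' t)\<^sup>2) - 0) * \<omega> (B i) (B j)"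
      unfolding Q_def integrand
      by (intro integral_unique has_integral_mult_left has_integral_diff has_integral_mult_right exact sq)
    moreover have "?p' \<noteq> 0"
    proof
      assume "?p' = 0"
      then have "(pderiv ^^ Suc (r + r' - 2)) \<eta> = 0"
        by (simp add: p_def)
      moreover have "\<eta> \<noteq> 0"
        by (simp add: \<eta>_def)
      ultimately have "degree \<eta> < Suc (r + r' - 2)"
        by (rule higher_pderiv_eq_0_imp_degree)
      moreover have "degree \<eta> = (r + r') + (r + r')"
        unfolding \<eta>_def by (subst degree_mult_eq) (simp_all add: degree_power_eq)
      ultimately show False
        using r by linarith
    qed
    then have "integral {0..1} (\<lambda>t. (poly ?p' t)\<^sup>2) > 0"
      by (rule integral_poly_pos)
    moreover have "\<omega> (B i) (B j) * \<omega> (B i) (B j) > 0"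
      using ij by (simp add: zero_less_mult_iff) linarith
    ultimately show ?thesis
      by (simp add: mult.assoc)
  qed
  ultimately have "\<forall>\<^sub>F \<epsilon> in at_right 0. Q \<epsilon> * \<omega> (B i) (B j) > 0"
    by (intro order_tendstoD(1)[of _ "Q 0 * \<omega> (B i) (B j)"] tendsto_intros)
       (auto simp: continuous_on_def intro: tendsto_within_subset)
  moreover have "\<forall>\<^sub>F \<epsilon> in at_right (0 :: real). \<epsilon> > 0"
    by (rule eventually_at_right_less)
  ultimately have "\<forall>\<^sub>F \<epsilon> in at_right 0. Q \<epsilon> * \<omega> (B i) (B j) > 0 \<and> \<epsilon> > 0"
    by (rule eventually_conj)
  then obtain \<epsilon> where "Q \<epsilon> * \<omega> (B i) (B j) > 0" "\<epsilon> > 0"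
    using eventually_happens'[OF trivial_limit_at_right_real] by blast
  then show ?thesis
    using that[of \<epsilon> "W \<epsilon>" "U \<epsilon>"] arc loop by (simp add: Q_def mult.commute)
qed

section \<open>Lifting arcs to trajectories in the group\<close>

text \<open>
  Stronger than what controllability asks of a single pair of points: the control is Borel measurable
  and bounded on the whole line, so that gluing two controls stays within the definition.
\<close>

definition steers ::
    "('n::finite heis \<Rightarrow> 'n heis) \<Rightarrow> ('m::finite \<Rightarrow> 'n heis \<Rightarrow> 'n heis) \<Rightarrow> 'n heis \<Rightarrow> 'n heis \<Rightarrow> bool"
  where "steers X B g h \<longleftrightarrow> (\<exists>u T \<gamma>. u \<in> borel_measurable borel \<and> bounded (range u) \<and>
    0 \<le> T \<and> trajectory X B u T \<gamma> \<and> \<gamma> 0 = g \<and> \<gamma> T = h)"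

lemma controllableI_steers:
  assumes "\<And>g h. steers X B g h"
  shows "controllable X B"
  unfolding controllable_def
proof (intro allI)
  fix g h
  obtain u T \<gamma> where u: "u \<in> borel_measurable borel" "bounded (range u)" and
    \<gamma>: "0 \<le> T" "trajectory X B u T \<gamma>" "\<gamma> 0 = g" "\<gamma> T = h"
    using assms[of g h] unfolding steers_def by blast
  have "u \<in> borel_measurable (lebesgue_on {0..})"
    using u(1) by (intro measurable_restrict_space1 measurable_completion) simp
  moreover have "bounded (u ` {0..T})" for T
    using u(2) by (rule bounded_subset) auto
  ultimately show "\<exists>u T \<gamma>. admissible_input u \<and> 0 \<le> T \<and> trajectory X B u T \<gamma> \<and> \<gamma> 0 = g \<and> \<gamma> T = h"
    using \<gamma> unfolding admissible_input_def by blast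
qed

lemma steers_trans:
  assumes "steers X B g h" "steers X B h k"
  shows "steers X B g k"
proof -
  obtain u1 T1 \<gamma>1 where u1: "u1 \<in> borel_measurable borel" "bounded (range u1)" and T1: "0 \<le> T1"
    and \<gamma>1: "trajectory X B u1 T1 \<gamma>1" "\<gamma>1 0 = g" "\<gamma>1 T1 = h"
    using assms(1) unfolding steers_def by blast
  obtain u2 T2 \<gamma>2 where u2: "u2 \<in> borel_measurable borel" "bounded (range u2)" and T2: "0 \<le> T2"
    and \<gamma>2: "trajectory X B u2 T2 \<gamma>2" "\<gamma>2 0 = h" "\<gamma>2 T2 = k"
    using assms(2) unfolding steers_def by blast
  define u where "u t = (if t \<le> T1 then u1 t else u2 (t - T1))" for t
  define \<gamma> where "\<gamma> t = (if t \<le> T1 then \<gamma>1 t else \<gamma>2 (t - T1))" for t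
  let ?F = "\<lambda>u \<gamma> s. X (\<gamma> s) + (\<Sum>j\<in>UNIV. (u s $ j) *\<^sub>R B j (\<gamma> s))"
  have "u \<in> borel_measurable borel"
    unfolding u_def using u1(1) u2(1) by measurable
  moreover have "bounded (range u)"
    using bounded_Un[THEN iffD2, OF conjI[OF u1(2) u2(2)]]
    by (rule bounded_subset) (auto simp: u_def)
  moreover have "trajectory X B u (T1 + T2) \<gamma>"
    unfolding trajectory_def
  proof (intro conjI ballI)
    have "continuous_on {0..T1} \<gamma>1"
      using \<gamma>1 unfolding trajectory_def by blast
    then have "continuous_on {0..T1} \<gamma>"
      by (rule continuous_on_eq) (simp add: \<gamma>_def)
    moreover have "continuous_on {T1..T1 + T2} \<gamma>"
    proof -
      have "continuous_on {0..T2} \<gamma>2"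
        using \<gamma>2 unfolding trajectory_def by blast
      then have "continuous_on {T1..T1 + T2} (\<lambda>t. \<gamma>2 (t - T1))"
        by (rule continuous_on_compose2) (auto intro!: continuous_intros)
      then show ?thesis
        by (rule continuous_on_eq) (use \<gamma>1 \<gamma>2 in \<open>auto simp: \<gamma>_def\<close>)
    qed
    moreover have "{0..T1 + T2} = {0..T1} \<union> {T1..T1 + T2}"
      using T1 T2 by auto
    ultimately show "continuous_on {0..T1 + T2} \<gamma>"
      by (simp add: continuous_on_closed_Un)
    fix t assume t: "t \<in> {0..T1 + T2}"
    have first: "(?F u \<gamma> has_integral (\<gamma> t - \<gamma> 0)) {0..t}" if "t \<in> {0..T1}" for t
    proof -
      have "(?F u1 \<gamma>1 has_integral (\<gamma>1 t - \<gamma>1 0)) {0..t}"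
        using \<gamma>1 that unfolding trajectory_def by blast
      then have "(?F u1 \<gamma>1 has_integral (\<gamma> t - \<gamma> 0)) {0..t}"
        using that by (simp add: \<gamma>_def)
      then show ?thesis
        by (rule has_integral_eq[rotated]) (use that in \<open>auto simp: u_def \<gamma>_def\<close>)
    qed
    show "(?F u \<gamma> has_integral (\<gamma> t - \<gamma> 0)) {0..t}"
    proof (cases "t \<le> T1")
      case True
      then show ?thesis
        using first t by simp
    next
      case False
      have "(?F u2 \<gamma>2 has_integral (\<gamma>2 (t - T1) - \<gamma>2 0)) (cbox 0 (t - T1))"
        using \<gamma>2 t False unfolding trajectory_def by simp
      from has_integral_affinity[OF this, of 1 "- T1"]
      have "((\<lambda>s. ?F u2 \<gamma>2 (s - T1)) has_integral (\<gamma>2 (t - T1) - \<gamma>2 0)) {T1..t}"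
        by (simp add: image_add_atLeastAtMost')
      then have "((\<lambda>s. ?F u2 \<gamma>2 (s - T1)) has_integral (\<gamma> t - \<gamma> T1)) {T1..t}"
        using False \<gamma>1 \<gamma>2 by (simp add: \<gamma>_def)
      \<comment> \<open>At the junction \<open>T1\<close> itself the glued control still has the value of \<open>u1\<close>, hence the spike.\<close>
      then have "(?F u \<gamma> has_integral (\<gamma> t - \<gamma> T1)) {T1..t}"
        by (rule has_integral_spike_finite[of "{T1}", rotated 2]) (auto simp: u_def \<gamma>_def)
      with first[of T1] have "(?F u \<gamma> has_integral (\<gamma> T1 - \<gamma> 0 + (\<gamma> t - \<gamma> T1))) {0..t}"
        using T1 False by (intro has_integral_combine[of 0 T1 t]) auto
      then show ?thesis
        by simp
    qed
  qed
  moreover have "\<gamma> 0 = g" "\<gamma> (T1 + T2) = k"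
    using T1 T2 \<gamma>1 \<gamma>2 by (auto simp: \<gamma>_def)
  ultimately show ?thesis
    unfolding steers_def using T1 T2
    by (intro exI[of _ u] exI[of _ "T1 + T2"] exI[of _ \<gamma>]) simp
qed

text \<open>
  Outside \<open>[0, T]\<close> the control is set to \<open>0\<close>, which makes it bounded.
\<close>

lemma steersI_C1:
  fixes X :: "'n::finite heis \<Rightarrow> 'n heis" and B :: "'m::finite \<Rightarrow> 'n heis \<Rightarrow> 'n heis"
  assumes u: "continuous_on UNIV u" and T: "0 \<le> T"
    and der: "\<And>t. t \<in> {0..T} \<Longrightarrow> (\<gamma> has_vector_derivative
      X (\<gamma> t) + (\<Sum>j\<in>UNIV. (u t $ j) *\<^sub>R B j (\<gamma> t))) (at t within {0..T})"
  shows "steers X B (\<gamma> 0) (\<gamma> T)"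
proof -
  define v where "v t = (if t \<in> {0..T} then u t else 0)" for t
  have "v \<in> borel_measurable borel"
    unfolding v_def using borel_measurable_continuous_onI[OF u] by measurable
  moreover have "bounded (range v)"
  proof -
    have "bounded (insert 0 (u ` {0..T}))"
      using continuous_on_subset[OF u] by (simp add: compact_imp_bounded compact_continuous_image)
    then show ?thesis
      by (rule bounded_subset) (auto simp: v_def)
  qed
  moreover have "trajectory X B v T \<gamma>"
    unfolding trajectory_def
  proof (intro conjI ballI)
    show "continuous_on {0..T} \<gamma>"
      using der by (meson continuous_on_eq_continuous_within has_vector_derivative_continuous)
    fix t assume t: "t \<in> {0..T}"
    have "((\<lambda>s. X (\<gamma> s) + (\<Sum>j\<in>UNIV. (u s $ j) *\<^sub>R B j (\<gamma> s))) has_integral (\<gamma> t - \<gamma> 0)) {0..t}"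
      using t by (intro fundamental_theorem_of_calculus)
        (auto intro!: has_vector_derivative_within_subset[OF der])
    then show "((\<lambda>s. X (\<gamma> s) + (\<Sum>j\<in>UNIV. (v s $ j) *\<^sub>R B j (\<gamma> s))) has_integral (\<gamma> t - \<gamma> 0)) {0..t}"
      by (rule has_integral_eq[rotated]) (use t in \<open>auto simp: v_def\<close>)
  qed
  ultimately show ?thesis
    unfolding steers_def using T by blast
qed

text \<open>
  The central coordinate of the lift is the initial value \<open>s\<close> plus the area swept so far; adding a
  central vector to \<open>w\<close> affects neither \<open>D w\<close> nor \<open>\<omega>(b, w)\<close>. Substituting \<open>t / \<epsilon>\<close> for \<open>t\<close> turns
  an arc with drift \<open>\<epsilon> D\<close> on \<open>[0, 1]\<close> into a trajectory with drift \<open>D\<close> on \<open>[0, \<epsilon>]\<close>.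
\<close>

lemma steers_of_linear_arc:
  fixes X :: "'n::finite heis \<Rightarrow> 'n heis" and b :: "'m::finite \<Rightarrow> 'n heis"
  assumes D: "linear D" "D unit_Z = 0" and X: "\<And>w. X (exp_coord w) = exp_coord_deriv w (D w)"
    and arc: "linear_arc (\<lambda>x. \<epsilon> *\<^sub>R D x) b w u" and \<epsilon>: "\<epsilon> > 0"
  shows "steers X (\<lambda>j. field_at_one (b j)) (exp_coord (w 0 + s *\<^sub>R unit_Z))
    (exp_coord (w 1 + (s + integral {0..1} (\<lambda>t. heis_omega (\<Sum>j\<in>UNIV. u t $ j *\<^sub>R b j) (w t))) *\<^sub>R unit_Z))"
proof -
  interpret \<omega>: bounded_bilinear heis_omega
    by (rule bounded_bilinear_heis_omega)
  define \<beta> where "\<beta> t = (\<Sum>j\<in>UNIV. u t $ j *\<^sub>R b j)" for t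
  define q where "q t = s + integral {0..t} (\<lambda>t. heis_omega (\<beta> t) (w t))" for t
  define W where "W t = w t + q t *\<^sub>R unit_Z" for t
  have u: "continuous_on UNIV u" and w: "(w has_vector_derivative \<epsilon> *\<^sub>R D (w t) + \<beta> t) (at t)" for t
    using arc unfolding linear_arc_def \<beta>_def by auto
  have "continuous_on UNIV w"
    using w by (meson continuous_on_eq_continuous_within has_vector_derivative_continuous)
  moreover have "continuous_on UNIV \<beta>"
    unfolding \<beta>_def[abs_def] by (intro continuous_intros u)
  ultimately have "continuous_on UNIV (\<lambda>t. heis_omega (\<beta> t) (w t))"
    by (intro \<omega>.continuous_on)
  then have "continuous_on {0..1} (\<lambda>t. heis_omega (\<beta> t) (w t))"
    by (rule continuous_on_subset) simp
  then have q: "(q has_vector_derivative heis_omega (\<beta> t) (w t)) (at t within {0..1})" if "t \<in> {0..1}" for t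
    unfolding q_def using that
    by (auto intro!: derivative_eq_intros integral_has_vector_derivative)
  have WZ: "heis_omega v (W t) = heis_omega v (w t)" for v t
    by (simp add: W_def heis_omega_def)
  have DW: "D (W t) = D (w t)" for t
    by (simp add: W_def linear_add[OF D(1)] linear_scale[OF D(1)] D(2) del: scaleR_Pair)
  have W: "((\<lambda>t. exp_coord (W t)) has_vector_derivative
      \<epsilon> *\<^sub>R X (exp_coord (W t)) + field_at_one (\<beta> t) (exp_coord (W t))) (at t within {0..1})"
    if t: "t \<in> {0..1}" for t
  proof -
    have "(W has_vector_derivative \<epsilon> *\<^sub>R D (w t) + \<beta> t + heis_omega (\<beta> t) (w t) *\<^sub>R unit_Z) (at t within {0..1})"
      unfolding W_def using q[OF t]
      by (intro has_vector_derivative_add has_vector_derivative_at_within[OF w])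
         (auto simp: has_vector_derivative_def intro!: derivative_eq_intros)
    then have "((exp_coord \<circ> W) has_vector_derivative
        exp_coord_deriv (W t) (\<epsilon> *\<^sub>R D (w t) + \<beta> t + heis_omega (\<beta> t) (w t) *\<^sub>R unit_Z)) (at t within {0..1})"
      unfolding has_vector_derivative_def
      by (rule has_derivative_eq_rhs[OF diff_chain_within[OF _ has_derivative_at_withinI[OF has_derivative_exp_coord]]])
         (simp add: fun_eq_iff linear_scale[OF linear_exp_coord_deriv])
    also have "exp_coord_deriv (W t) (\<epsilon> *\<^sub>R D (w t) + \<beta> t + heis_omega (\<beta> t) (w t) *\<^sub>R unit_Z) =
        \<epsilon> *\<^sub>R X (exp_coord (W t)) + field_at_one (\<beta> t) (exp_coord (W t))"
      unfolding X exp_coord_deriv_field_at_one[symmetric] WZ DW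
      by (simp only: linear_add[OF linear_exp_coord_deriv] linear_scale[OF linear_exp_coord_deriv] add.assoc)
    finally show ?thesis
      by (simp add: o_def)
  qed
  define v where "v t = (1 / \<epsilon>) *\<^sub>R u (t / \<epsilon>)" for t
  have "continuous_on UNIV v"
    unfolding v_def by (intro continuous_intros continuous_on_compose2[OF u]) (use \<epsilon> in auto)
  moreover have "((\<lambda>t. exp_coord (W (t / \<epsilon>))) has_vector_derivative X (exp_coord (W (t / \<epsilon>))) +
      (\<Sum>j\<in>UNIV. v t $ j *\<^sub>R field_at_one (b j) (exp_coord (W (t / \<epsilon>))))) (at t within {0..\<epsilon>})"
    if t: "t \<in> {0..\<epsilon>}" for t
  proof -
    have img: "(\<lambda>t. t / \<epsilon>) ` {0..\<epsilon>} \<subseteq> {0..1}"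
      using \<epsilon> by auto
    have "(((\<lambda>t. exp_coord (W t)) \<circ> (\<lambda>t. t / \<epsilon>)) has_vector_derivative (1 / \<epsilon>) *\<^sub>R
        (\<epsilon> *\<^sub>R X (exp_coord (W (t / \<epsilon>))) + field_at_one (\<beta> (t / \<epsilon>)) (exp_coord (W (t / \<epsilon>)))))
        (at t within {0..\<epsilon>})"
      using t \<epsilon>
      by (intro vector_diff_chain_within has_vector_derivative_within_subset[OF W img])
         (auto intro!: derivative_eq_intros)
    moreover have "field_at_one (\<beta> (t / \<epsilon>)) g = (\<Sum>j\<in>UNIV. u (t / \<epsilon>) $ j *\<^sub>R field_at_one (b j) g)" for g
    proof -
      have lin: "linear (\<lambda>e. field_at_one e g)"
        by (rule linearI) (auto simp: field_at_one_apply inner_add_left algebra_simps)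
      show ?thesis
        unfolding \<beta>_def by (simp only: linear_sum[OF lin] linear_scale[OF lin])
    qed
    ultimately show ?thesis
      using \<epsilon> by (simp add: o_def v_def scaleR_add_right scaleR_sum_right)
  qed
  ultimately have "steers X (\<lambda>j. field_at_one (b j)) (exp_coord (W (0 / \<epsilon>))) (exp_coord (W (\<epsilon> / \<epsilon>)))"
    using steersI_C1[of v \<epsilon> "\<lambda>t. exp_coord (W (t / \<epsilon>))"] \<epsilon> by simp
  then show ?thesis
    using \<epsilon> by (simp add: W_def q_def \<beta>_def del: scaleR_Pair)
qed

text \<open>
  An arc between points of the center can be multiplied by any \<open>\<sigma>\<close>: its end point scales linearly and
  its area quadratically.
\<close>

lemma steers_of_scaled_central_arc:
  fixes X :: "'n::finite heis \<Rightarrow> 'n heis" and b :: "'m::finite \<Rightarrow> 'n heis"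
  assumes D: "linear D" "D unit_Z = 0" and X: "\<And>w. X (exp_coord w) = exp_coord_deriv w (D w)"
    and arc: "linear_arc (\<lambda>x. \<epsilon> *\<^sub>R D x) b w u" "\<epsilon> > 0" "w 0 = 0" "w 1 = \<mu> *\<^sub>R unit_Z"
  defines "Q \<equiv> integral {0..1} (\<lambda>t. heis_omega (\<Sum>j\<in>UNIV. u t $ j *\<^sub>R b j) (w t))"
  shows "steers X (\<lambda>j. field_at_one (b j)) (exp_coord (s *\<^sub>R unit_Z))
    (exp_coord ((s + (\<sigma> * \<mu> + \<sigma>\<^sup>2 * Q)) *\<^sub>R unit_Z))"
proof -
  interpret \<omega>: bounded_bilinear heis_omega
    by (rule bounded_bilinear_heis_omega)
  have "linear (\<lambda>x. \<epsilon> *\<^sub>R D x)"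
    using D(1) by (rule linear_compose_scale_right)
  then have "linear_arc (\<lambda>x. \<epsilon> *\<^sub>R D x) b (\<lambda>t. \<sigma> *\<^sub>R w t) (\<lambda>t. \<sigma> *\<^sub>R u t)"
    using arc(1) by (rule linear_arc_scale)
  note steers_of_linear_arc[OF D X this arc(2), of s]
  moreover have "heis_omega (\<Sum>j\<in>UNIV. (\<sigma> *\<^sub>R u t) $ j *\<^sub>R b j) (\<sigma> *\<^sub>R w t) =
      \<sigma>\<^sup>2 * heis_omega (\<Sum>j\<in>UNIV. u t $ j *\<^sub>R b j) (w t)" for t
  proof -
    have "(\<Sum>j\<in>UNIV. (\<sigma> *\<^sub>R u t) $ j *\<^sub>R b j) = \<sigma> *\<^sub>R (\<Sum>j\<in>UNIV. u t $ j *\<^sub>R b j)"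
      by (simp add: scaleR_sum_right)
    then show ?thesis
      by (simp only: \<omega>.scaleR_left \<omega>.scaleR_right real_scaleR_def power2_eq_square mult.assoc)
  qed
  ultimately show ?thesis
    by (simp add: arc(3,4) Q_def algebra_simps flip: scaleR_add_left del: scaleR_Pair)
qed

text \<open>
  Repeating the arc scaled by \<open>\<sigma>\<close> \<open>n\<close> times displaces by \<open>n (\<sigma> + \<sigma>\<^sup>2 Q)\<close>. When
  \<open>Q \<noteq> 0\<close>, the values of \<open>\<sigma> + \<sigma>\<^sup>2 Q\<close> fill only a half-line, but that half-line
  contains a neighborhood of \<open>0\<close>, so \<open>r / n\<close> is attained for large \<open>n\<close>.
\<close>

lemma steers_along_center_of_span:
  fixes X :: "'n::finite heis \<Rightarrow> 'n heis" and b :: "'m::finite \<Rightarrow> 'n heis"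
  assumes D: "linear D" "D unit_Z = 0" and X: "\<And>w. X (exp_coord w) = exp_coord_deriv w (D w)"
    and Z: "unit_Z \<in> span {(D ^^ k) (b i) | k i. True}"
  shows "steers X (\<lambda>j. field_at_one (b j)) (exp_coord (s *\<^sub>R unit_Z)) (exp_coord ((s + r) *\<^sub>R unit_Z))"
proof -
  let ?steers = "\<lambda>s s'. steers X (\<lambda>j. field_at_one (b j)) (exp_coord (s *\<^sub>R unit_Z)) (exp_coord (s' *\<^sub>R unit_Z))"
  obtain w u where arc: "linear_arc D b w u" "w 0 = 0" "w 1 = unit_Z"
    using kalman_steer_from_zero[OF D(1) Z] by blast
  define Q where "Q = integral {0..1} (\<lambda>t. heis_omega (\<Sum>j\<in>UNIV. u t $ j *\<^sub>R b j) (w t))"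
  have step: "?steers s (s + (\<sigma> + \<sigma>\<^sup>2 * Q))" for s \<sigma>
    using steers_of_scaled_central_arc[where X = X and b = b and \<epsilon> = 1 and \<mu> = 1 and w = w and u = u
        and D = D and s = s and \<sigma> = \<sigma>] arc D X by (simp add: Q_def del: scaleR_Pair)
  have steps: "?steers s (s + Suc n * (\<sigma> + \<sigma>\<^sup>2 * Q))" for n \<sigma>
  proof (induction n)
    case 0
    then show ?case
      using step[of s \<sigma>] by (simp del: scaleR_Pair)
  next
    case (Suc n)
    from steers_trans[OF Suc step[of _ \<sigma>]]
    show ?case
      by (simp add: algebra_simps del: scaleR_Pair)
  qed
  have "\<exists>n \<sigma>. r = Suc n * (\<sigma> + \<sigma>\<^sup>2 * Q)"
  proof (cases "Q = 0")
    case True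
    then show ?thesis
      by (intro exI[of _ 0] exI[of _ r]) simp
  next
    case False
    obtain n where n: "\<bar>4 * Q * r\<bar> \<le> real n"
      using real_arch_simple by blast
    define y where "y = r / Suc n"
    have "\<bar>4 * Q * y\<bar> \<le> 1"
      using n by (simp add: y_def abs_mult abs_divide divide_le_eq)
    then have pos: "0 \<le> 1 + 4 * Q * y"
      by linarith
    \<comment> \<open>The root of \<open>\<sigma> + \<sigma>\<^sup>2 Q = y\<close> that tends to \<open>0\<close> with \<open>y\<close>.\<close>
    define \<sigma> where "\<sigma> = (sqrt (1 + 4 * Q * y) - 1) / (2 * Q)"
    have "\<sigma> + \<sigma>\<^sup>2 * Q = ((sqrt (1 + 4 * Q * y))\<^sup>2 - 1) / (4 * Q)"
      using False by (simp add: \<sigma>_def power2_eq_square field_simps)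
    also have "\<dots> = y"
      using False pos by simp
    finally have "r = Suc n * (\<sigma> + \<sigma>\<^sup>2 * Q)"
      by (simp add: y_def)
    then show ?thesis by blast
  qed
  then show ?thesis
    using steps by blast
qed

text \<open>
  Exchanging \<open>i\<close> and \<open>j\<close> reverses the sign of the area, so loops with the sign of \<open>r\<close> exist.
\<close>

lemma steers_along_center_of_area:
  fixes X :: "'n::finite heis \<Rightarrow> 'n heis" and b :: "'m::finite \<Rightarrow> 'n heis"
  assumes D: "linear D" "D unit_Z = 0" and X: "\<And>w. X (exp_coord w) = exp_coord_deriv w (D w)"
    and ij: "heis_omega (b i) (b j) \<noteq> 0"
  shows "steers X (\<lambda>j. field_at_one (b j)) (exp_coord (s *\<^sub>R unit_Z)) (exp_coord ((s + r) *\<^sub>R unit_Z))"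
proof -
  have "?thesis" if ij: "heis_omega (b i) (b j) \<noteq> 0" and r: "0 \<le> r * heis_omega (b i) (b j)" for i j
  proof -
    obtain \<epsilon> w u where arc: "\<epsilon> > 0" "linear_arc (\<lambda>x. \<epsilon> *\<^sub>R D x) b w u" "w 0 = 0" "w 1 = 0" and
      pos: "0 < heis_omega (b i) (b j) *
        integral {0..1} (\<lambda>t. heis_omega (\<Sum>k\<in>UNIV. u t $ k *\<^sub>R b k) (w t))"
      using exists_loop_with_signed_area[where D = D and B = b and \<omega> = heis_omega and i = i and j = j,
          OF D(1) bounded_bilinear_heis_omega heis_omega_alt ij] by blast
    define Q where "Q = integral {0..1} (\<lambda>t. heis_omega (\<Sum>k\<in>UNIV. u t $ k *\<^sub>R b k) (w t))"
    have "0 \<le> r / Q" "Q \<noteq> 0"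
      using pos r unfolding Q_def[symmetric]
      by (auto simp: zero_less_mult_iff zero_le_mult_iff zero_le_divide_iff)
    then have "(sqrt (r / Q))\<^sup>2 * Q = r"
      by simp
    then show ?thesis
      using steers_of_scaled_central_arc[where X = X and b = b and \<epsilon> = \<epsilon> and \<mu> = 0 and w = w and u = u
        and D = D and s = s and \<sigma> = "sqrt (r / Q)"] arc D X by (simp add: Q_def del: scaleR_Pair)
  qed
  moreover have "heis_omega (b j) (b i) = - heis_omega (b i) (b j)"
    by (simp add: heis_omega_def inner_commute field_simps)
  ultimately show ?thesis
    using ij by (metis linear mult_minus_right neg_0_le_iff_le neg_equal_0_iff_equal)
qed

section \<open>The ad-rank condition and controllability\<close>

text \<open>
  The form in which the ad-rank condition is used. The subspace \<open>M\<close> is closed under brackets, so it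
  contains the subalgebra generated by the controlled fields; \<open>N\<close> is invariant under \<open>D\<close>, so it contains
  everything obtained from \<open>M\<close> by iterating \<open>D\<close>.
\<close>

lemma ad_rank_fill:
  fixes X :: "'n::finite heis \<Rightarrow> 'n heis" and b :: "'m::finite \<Rightarrow> 'n heis"
  assumes ad: "ad_rank_condition X (\<lambda>j. field_at_one (b j))"
    and D: "\<And>e. derivation X (field_at_one e) = field_at_one (D e)"
    and M: "subspace M" "\<And>j. b j \<in> M" "\<And>v w. v \<in> M \<Longrightarrow> w \<in> M \<Longrightarrow> heis_omega v w *\<^sub>R unit_Z \<in> M"
    and N: "subspace N" "M \<subseteq> N" "\<And>v. v \<in> N \<Longrightarrow> D v \<in> N"
  shows "N = UNIV"
proof -
  have "lie_subalgebra (field_at_one ` M)"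
    unfolding lie_subalgebra_def
  proof (intro conjI ballI)
    show "field_at_one ` M \<subseteq> heis_algebra"
      using range_field_at_one by blast
    show "subspace (field_at_one ` M)"
      by (rule linear_subspace_image[OF linear_field_at_one M(1)])
    fix V W assume "V \<in> field_at_one ` M" "W \<in> field_at_one ` M"
    then obtain v w where "V = field_at_one v" "W = field_at_one w" "v \<in> M" "w \<in> M"
      by blast
    moreover have "2 *\<^sub>R (heis_omega w v *\<^sub>R unit_Z) \<in> M" if "w \<in> M" "v \<in> M" for v w
      using M(1) M(3)[OF that] by (rule subspace_scale)
    ultimately show "lie_bracket V W \<in> field_at_one ` M"
      by (auto simp: lie_bracket_field_at_one intro!: imageI simp flip: scaleR_scaleR simp del: scaleR_Pair)
  qed
  then have hull: "lie_subalgebra hull (range (\<lambda>j. field_at_one (b j))) \<subseteq> field_at_one ` M"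
    using M(2) by (intro hull_minimal) auto
  have "(derivation X ^^ k) V \<in> field_at_one ` N" if "V \<in> field_at_one ` M" for k V
    using that N(2,3) by (induction k) (auto simp: D)
  then have "{(derivation X ^^ k) V | k V. V \<in> lie_subalgebra hull (range (\<lambda>j. field_at_one (b j)))}
      \<subseteq> field_at_one ` N"
    using hull by auto
  then have "heis_algebra \<subseteq> field_at_one ` N"
    using ad linear_subspace_image[OF linear_field_at_one N(1)] unfolding ad_rank_condition_def
    by (metis (no_types, lifting) span_minimal)
  then have "UNIV \<subseteq> N"
    by (simp only: range_field_at_one[symmetric] inj_image_subset_iff[OF inj_field_at_one])
  then show ?thesis
    by blast
qed

text \<open>
  If \<open>\<omega>\<close> vanishes on the controlled directions, their span is already a subalgebra, and the ad-rank
  condition says \<open>K = UNIV\<close>. Otherwise the span of \<open>K\<close> and \<open>Z\<close> contains all brackets and is invariant under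
  \<open>D\<close> because \<open>D Z = 0\<close>, so it is everything.
\<close>

lemma ad_rank_dichotomy:
  fixes X :: "'n::finite heis \<Rightarrow> 'n heis" and b :: "'m::finite \<Rightarrow> 'n heis"
  assumes ad: "ad_rank_condition X (\<lambda>j. field_at_one (b j))"
    and lin: "linear D" and DZ: "D unit_Z = 0"
    and D: "\<And>e. derivation X (field_at_one e) = field_at_one (D e)"
  defines "K \<equiv> span {(D ^^ k) (b i) | k i. True}"
  shows "\<exists>z. g + z *\<^sub>R unit_Z \<in> K" and "unit_Z \<in> K \<or> (\<exists>i j. heis_omega (b i) (b j) \<noteq> 0)"
proof -
  interpret \<omega>: bounded_bilinear heis_omega
    by (rule bounded_bilinear_heis_omega)
  have K: "subspace K"
    unfolding K_def by (rule subspace_span)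
  have bK: "b j \<in> K" for j
    unfolding K_def by (intro span_base CollectI exI[of _ 0] exI[of _ j]) simp
  have DK: "D ` K \<subseteq> K"
  proof -
    have "D ((D ^^ k) (b i)) \<in> K" for k i
      unfolding K_def by (intro span_base CollectI exI[of _ "Suc k"] exI[of _ i]) simp
    then show ?thesis
      unfolding K_def linear_span_image[OF lin, symmetric] by (intro span_minimal) (auto simp: subspace_span)
  qed
  have "(\<forall>g. \<exists>z. g + z *\<^sub>R unit_Z \<in> K) \<and> (unit_Z \<in> K \<or> (\<exists>i j. heis_omega (b i) (b j) \<noteq> 0))"
  proof (cases "\<exists>i j. heis_omega (b i) (b j) \<noteq> 0")
    case True
    have "D ` span (insert unit_Z K) \<subseteq> span (insert unit_Z K)"
      unfolding linear_span_image[OF lin, symmetric]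
      using DK by (intro span_minimal subspace_span) (auto simp: DZ span_zero intro: span_base)
    then have "span (insert unit_Z K) = UNIV"
      by (intro ad_rank_fill[OF ad D, of "span (insert unit_Z K)"])
         (auto intro: span_base span_scale bK simp: subspace_span simp del: scaleR_Pair)
    moreover have "span K = K"
      using K by (simp only: span_eq_iff)
    ultimately have mod: "\<exists>z. g - z *\<^sub>R unit_Z \<in> K" for g
      unfolding span_insert by blast
    have "\<exists>z. g + z *\<^sub>R unit_Z \<in> K" for g
    proof -
      obtain z where "g - z *\<^sub>R unit_Z \<in> K"
        using mod by blast
      then have "g + (- z) *\<^sub>R unit_Z \<in> K"
        by (simp del: scaleR_Pair)
      then show ?thesis ..
    qed
    with True show ?thesis by blast
  next
    case False
    have vanish: "heis_omega v w = 0" if v: "v \<in> span (range b)" and w: "w \<in> span (range b)" for v w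
    proof -
      have "heis_omega (b i) w = 0" for i
        by (rule linear_eq_0_on_span[OF bounded_linear.linear[OF \<omega>.bounded_linear_right] _ w]) (use False in auto)
      then show ?thesis
        by (intro linear_eq_0_on_span[OF bounded_linear.linear[OF \<omega>.bounded_linear_left] _ v]) auto
    qed
    have "K = UNIV"
    proof (rule ad_rank_fill[OF ad D, of "span (range b)"])
      show "span (range b) \<subseteq> K"
        using bK K by (intro span_minimal) auto
      show "heis_omega v w *\<^sub>R unit_Z \<in> span (range b)" if "v \<in> span (range b)" "w \<in> span (range b)" for v w
        using vanish[OF that] by (simp add: span_zero del: scaleR_Pair)
    qed (use K DK in \<open>auto intro: span_base\<close>)
    then show ?thesis by auto
  qed
  then show "\<exists>z. g + z *\<^sub>R unit_Z \<in> K" and "unit_Z \<in> K \<or> (\<exists>i j. heis_omega (b i) (b j) \<noteq> 0)"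
    by blast+
qed

theorem theorem6:
  fixes X :: "'n::finite heis \<Rightarrow> 'n heis"
    and B :: "'m::finite \<Rightarrow> 'n heis \<Rightarrow> 'n heis"
    and Z :: "'n heis \<Rightarrow> 'n heis"
    and d :: real
  assumes system: "linear_system X B"
    and center: "span {Z} = heis_center"
    and eigenvalue: "derivation X Z = d *\<^sub>R Z"
    and ad_rank: "ad_rank_condition X B"
    and singular: "d = 0"
  shows "controllable X B"
proof -
  have "\<forall>j. \<exists>e. B j = field_at_one e"
    using system unfolding linear_system_def range_field_at_one[symmetric] by blast
  then obtain b where B: "B = (\<lambda>j. field_at_one (b j))"
    by (metis ext)
  obtain c where c: "c \<noteq> 0" "Z = field_at_one (c *\<^sub>R unit_Z)"
    using center by (rule center_generator)
  have "linear_vector_field X" "derivation X (field_at_one (c *\<^sub>R unit_Z)) = 0"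
    using system eigenvalue singular by (simp_all add: linear_system_def c(2) del: scaleR_Pair)
  then obtain D where D: "linear D" "D unit_Z = 0" and X: "\<And>w. X (exp_coord w) = exp_coord_deriv w (D w)"
    and deriv: "\<And>e. derivation X (field_at_one e) = field_at_one (D e)"
    using linear_vector_field_exp_coord c(1) by metis
  note ad = ad_rank_dichotomy[OF ad_rank[unfolded B] D deriv]
  have along_center: "steers X B (exp_coord (s *\<^sub>R unit_Z)) (exp_coord (s' *\<^sub>R unit_Z))" for s s'
  proof -
    have "steers X B (exp_coord (s *\<^sub>R unit_Z)) (exp_coord ((s + (s' - s)) *\<^sub>R unit_Z))"
      using ad(2) steers_along_center_of_span[OF D X] steers_along_center_of_area[OF D X]
      unfolding B by blast
    then show ?thesis
      by (simp del: scaleR_Pair)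
  qed
  have one: "linear_arc (\<lambda>x. 1 *\<^sub>R D x) b w u" if "linear_arc D b w u" for w u
    using that by simp
  have steer_exp: "steers X B (exp_coord g) (exp_coord h)" for g h
  proof -
    obtain z where "g + z *\<^sub>R unit_Z \<in> span {(D ^^ k) (b i) | k i. True}"
      using ad(1) by blast
    then obtain w u where w: "linear_arc D b w u" "w 0 = g + z *\<^sub>R unit_Z" "w 1 = 0"
      using kalman_steer_to_zero[OF D(1)] by blast
    obtain s where to: "steers X B (exp_coord g) (exp_coord (s *\<^sub>R unit_Z))"
      using steers_of_linear_arc[OF D X one[OF w(1)] zero_less_one, of "- z"]
      unfolding B w by (auto simp del: scaleR_Pair)
    obtain z' where "h + z' *\<^sub>R unit_Z \<in> span {(D ^^ k) (b i) | k i. True}"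
      using ad(1) by blast
    then obtain w' u' where w': "linear_arc D b w' u'" "w' 0 = 0" "w' 1 = h + z' *\<^sub>R unit_Z"
      using kalman_steer_from_zero[OF D(1)] by blast
    define Q where "Q = integral {0..1} (\<lambda>t. heis_omega (\<Sum>j\<in>UNIV. u' t $ j *\<^sub>R b j) (w' t))"
    have "steers X B (exp_coord ((- z' - Q) *\<^sub>R unit_Z)) (exp_coord h)"
      using steers_of_linear_arc[OF D X one[OF w'(1)] zero_less_one, of "- z' - Q"]
      unfolding B w' Q_def[symmetric] by (simp add: add.assoc del: scaleR_Pair flip: scaleR_add_left)
    with to show ?thesis
      using along_center steers_trans by blast
  qed
  have "\<exists>w. exp_coord w = g" for g :: "'n heis"
    by (intro exI[of _ "(fst g, fst (snd g), snd (snd g) - fst g \<bullet> fst (snd g) / 2)"])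
       (simp add: exp_coord_def)
  then show ?thesis
    using steer_exp by (intro controllableI_steers) metis
qed

end
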